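(* Let $\mathcal{A}$ be a noncommutative $C^*$-algebra with a lower semicontinuous faithful trace $\tau$ and let $U_1,\dots,U_n\in\mathcal{A}$ be a differential basis. Then $\triangle=\sum_{j=1}^n[U_j^*,[U_j,\cdot\,]]$ is strongly local.
   Context: Differential basis: elements $U_1,\dots,U_n\in\mathcal{A}$ such that (I) each $U_j$ is not self-adjoint, and (II) the elements $U_1,U_1^*,\dots,U_n,U_n^*$ mutually commute. Here $[x,y]=xy-yx$. The operator $\triangle$ is regarded as the generator of the completely positive Markov semigroup $e^{-t\triangle}$. Associated with $\triangle$ is the $\mathcal{A}$-valued sesquilinear form on the right $\mathcal{A}$-module $\mathcal{A}\otimes\mathcal{A}$ (right action on the second factor) given by $$\langle a\otimes b,c\otimes d\rangle_{\mathcal{A}}=b^*\bigl(a^*\triangle(c)+\triangle(a^* )c-\triangle(a^*c)\bigr)d ,$$ and $\mathcal{A}\otimes\mathcal{A}$ denotes the Hilbert $\mathcal{A}$-module obtained from this form (separating and completing). Strongly local: a completely positive Markov semigroup $(\Phi_t)_{t\ge0}$ and its generator $\triangle$ are strongly local if there exist a Hilbert space $\mathbb{H}$ and an isometry $W\in\mathcal{L}_{\mathcal{A}}(\mathcal{A}\otimes\mathcal{A},\mathbb{H}\otimes\mathcal{A})$, i.e. a right $\mathcal{A}$-linear map $W:\mathcal{A}\otimes\mathcal{A}\to\mathbb{H}\otimes\mathcal{A}$ preserving the $\mathcal{A}$-valued inner products, where $\mathbb{H}\otimes\mathcal{A}$ is the standard Hilbert $\mathcal{A}$-module with $\langle\xi\otimes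 b,\eta\otimes d\rangle=\langle\xi,\eta\rangle b^*d$. *)

theory Defs
  imports "HOL-Analysis.Analysis" "HOL-Library.Poly_Mapping"
begin

section \<open>C*-algebras\<close>

text \<open>No unit is assumed: the parent class \<open>real_normed_algebra\<close> is not unital.\<close>

class cstar_algebra = real_normed_algebra + banach +
  fixes scaleC :: "complex \<Rightarrow> 'a \<Rightarrow> 'a" (infixr "*\<^sub>C" 75)
    and star :: "'a \<Rightarrow> 'a"
  assumes scaleC_of_real: "of_real r *\<^sub>C x = r *\<^sub>R x"
    and scaleC_add_right: "c *\<^sub>C (x + y) = c *\<^sub>C x + c *\<^sub>C y"
    and scaleC_add_left: "(c + d) *\<^sub>C x = c *\<^sub>C x + d *\<^sub>C x"
    and scaleC_scaleC: "c *\<^sub>C (d *\<^sub>C x) = (c * d) *\<^sub>C x"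
    and norm_scaleC: "norm (c *\<^sub>C x) = cmod c * norm x"
    and mult_scaleC_left: "(c *\<^sub>C x) * y = c *\<^sub>C (x * y)"
    and mult_scaleC_right: "x * (c *\<^sub>C y) = c *\<^sub>C (x * y)"
    and star_add: "star (x + y) = star x + star y"
    and star_scaleC: "star (c *\<^sub>C x) = cnj c *\<^sub>C star x"
    and star_mult: "star (x * y) = star y * star x"
    and star_star: "star (star x) = x"
    and cstar_identity: "norm (star x * x) = (norm x)\<^sup>2"

instantiation complex :: cstar_algebra
begin

definition scaleC_complex :: "complex \<Rightarrow> complex \<Rightarrow> complex"
  where "scaleC_complex = (*)"

definition star_complex :: "complex \<Rightarrow> complex"
  where "star_complex = cnj"

instance
  by standard
    (auto simp: scaleC_complex_def star_complex_def algebra_simps scaleR_conv_of_real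
      norm_mult power2_eq_square)

end

definition commutator :: "'a::cstar_algebra \<Rightarrow> 'a \<Rightarrow> 'a"
  where "commutator x y = x * y - y * x"

definition positive :: "'a::cstar_algebra \<Rightarrow> bool"
  where "positive x \<longleftrightarrow> (\<exists>y. x = star y * y)"

definition complex_linear :: "('a::cstar_algebra \<Rightarrow> 'a) \<Rightarrow> bool"
  where "complex_linear f \<longleftrightarrow>
    (\<forall>x y. f (x + y) = f x + f y) \<and> (\<forall>c x. f (c *\<^sub>C x) = c *\<^sub>C f x)"


section \<open>Traces\<close>

text \<open>A trace is a \<open>[0,\<infinity>]\<close>-valued weight on the positive cone. The HOL function \<open>\<tau>\<close> is
  total, but its values off the positive cone are irrelevant.\<close>

definition is_trace :: "('a::cstar_algebra \<Rightarrow> ennreal) \<Rightarrow> bool"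
  where "is_trace \<tau> \<longleftrightarrow>
    (\<forall>x y. positive x \<longrightarrow> positive y \<longrightarrow> \<tau> (x + y) = \<tau> x + \<tau> y) \<and>
    (\<forall>r x. 0 \<le> r \<longrightarrow> positive x \<longrightarrow> \<tau> (r *\<^sub>R x) = ennreal r * \<tau> x) \<and>
    (\<forall>x. \<tau> (star x * x) = \<tau> (x * star x))"

definition lower_semicontinuous_trace :: "('a::cstar_algebra \<Rightarrow> ennreal) \<Rightarrow> bool"
  where "lower_semicontinuous_trace \<tau> \<longleftrightarrow>
    (\<forall>c. closedin (top_of_set {x. positive x}) {x. positive x \<and> \<tau> x \<le> c})"

definition faithful_trace :: "('a::cstar_algebra \<Rightarrow> ennreal) \<Rightarrow> bool"
  where "faithful_trace \<tau> \<longleftrightarrow> (\<forall>x. positive x \<longrightarrow> \<tau> x = 0 \<longrightarrow> x = 0)"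


section \<open>Differential bases\<close>

definition differential_basis :: "nat \<Rightarrow> (nat \<Rightarrow> 'a::cstar_algebra) \<Rightarrow> bool"
  where "differential_basis n U \<longleftrightarrow>
    (\<forall>j\<in>{1..n}. star (U j) \<noteq> U j) \<and>
    (\<forall>x \<in> U ` {1..n} \<union> star ` U ` {1..n}. \<forall>y \<in> U ` {1..n} \<union> star ` U ` {1..n}.
      commutator x y = 0)"


section \<open>Completely positive Markov semigroups\<close>

text \<open>Complete positivity in its dilation form: \<open>\<Sum> b\<^sub>i\<^sup>* \<Phi>(a\<^sub>i\<^sup>* a\<^sub>j) b\<^sub>j \<ge> 0\<close> for all finite families. For a
  C*-algebra this is positivity of \<open>\<Phi>\<close> applied entrywise to \<open>m \<times> m\<close> matrices, for every \<open>m\<close>.\<close>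

definition completely_positive :: "('a::cstar_algebra \<Rightarrow> 'a) \<Rightarrow> bool"
  where "completely_positive \<Phi> \<longleftrightarrow> complex_linear \<Phi> \<and>
    (\<forall>m (a :: nat \<Rightarrow> 'a) b.
      positive (\<Sum>i<m. \<Sum>j<m. star (b i) * \<Phi> (star (a i) * a j) * b j))"

text \<open>The last clause says that \<open>\<Phi> t\<close> is unital whenever the algebra has a unit \<open>e\<close>; without a
  unit, the Markov property is contractivity.\<close>

definition cp_markov_semigroup :: "(real \<Rightarrow> 'a::cstar_algebra \<Rightarrow> 'a) \<Rightarrow> bool"
  where "cp_markov_semigroup \<Phi> \<longleftrightarrow>
    (\<forall>x. \<Phi> 0 x = x) \<and>
    (\<forall>s\<ge>0. \<forall>t\<ge>0. \<forall>x. \<Phi> (s + t) x = \<Phi> s (\<Phi> t x)) \<and>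
    (\<forall>x. ((\<lambda>t. \<Phi> t x) \<longlongrightarrow> x) (at_right 0)) \<and>
    (\<forall>t\<ge>0. completely_positive (\<Phi> t)) \<and>
    (\<forall>t\<ge>0. \<forall>x. norm (\<Phi> t x) \<le> norm x) \<and>
    (\<forall>e. (\<forall>x. e * x = x \<and> x * e = x) \<longrightarrow> (\<forall>t\<ge>0. \<Phi> t e = e))"

text \<open>Sign convention: \<open>\<Phi> t = e\<^sup>-\<^sup>t\<^sup>\<Delta>\<close>. The generator is everywhere defined.\<close>

definition is_generator :: "(real \<Rightarrow> 'a::cstar_algebra \<Rightarrow> 'a) \<Rightarrow> ('a \<Rightarrow> 'a) \<Rightarrow> bool"
  where "is_generator \<Phi> \<Delta> \<longleftrightarrow>
    (\<forall>x. ((\<lambda>t. (1 / t) *\<^sub>R (x - \<Phi> t x)) \<longlongrightarrow> \<Delta> x) (at_right 0))"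

definition exp_semigroup :: "('a::cstar_algebra \<Rightarrow> 'a) \<Rightarrow> real \<Rightarrow> 'a \<Rightarrow> 'a"
  where "exp_semigroup \<Delta> t x = suminf (\<lambda>k. ((- t) ^ k / fact k) *\<^sub>R (\<Delta> ^^ k) x)"


section \<open>Right modules with an algebra-valued inner product\<close>

record ('a, 'e) ip_module =
  carrier :: "'e set"
  zero :: "'e"
  add :: "'e \<Rightarrow> 'e \<Rightarrow> 'e"
  smul :: "complex \<Rightarrow> 'e \<Rightarrow> 'e"
  act :: "'e \<Rightarrow> 'a \<Rightarrow> 'e"
  ip :: "'e \<Rightarrow> 'e \<Rightarrow> 'a"

definition seminorm :: "('a::cstar_algebra, 'e) ip_module \<Rightarrow> 'e \<Rightarrow> real"
  where "seminorm M x = sqrt (norm (ip M x x))"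

definition sub :: "('a::cstar_algebra, 'e) ip_module \<Rightarrow> 'e \<Rightarrow> 'e \<Rightarrow> 'e"
  where "sub M x y = add M x (smul M (- 1) y)"

definition cauchy_in :: "('a::cstar_algebra, 'e) ip_module \<Rightarrow> (nat \<Rightarrow> 'e) \<Rightarrow> bool"
  where "cauchy_in M X \<longleftrightarrow> range X \<subseteq> carrier M \<and>
    (\<forall>\<epsilon>>0. \<exists>N. \<forall>m\<ge>N. \<forall>n\<ge>N. seminorm M (sub M (X m) (X n)) < \<epsilon>)"

text \<open>Inner products are conjugate linear in the first and linear in the second variable.\<close>

definition hilbert_module :: "('a::cstar_algebra, 'e) ip_module \<Rightarrow> bool"
  where "hilbert_module M \<longleftrightarrow>
    zero M \<in> carrier M \<and>
    (\<forall>x\<in>carrier M. \<forall>y\<in>carrier M. add M x y \<in> carrier M) \<and>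
    (\<forall>x\<in>carrier M. \<forall>c. smul M c x \<in> carrier M) \<and>
    (\<forall>x\<in>carrier M. \<forall>a. act M x a \<in> carrier M) \<and>
    (\<forall>x\<in>carrier M. \<forall>y\<in>carrier M. \<forall>z\<in>carrier M.
      add M (add M x y) z = add M x (add M y z)) \<and>
    (\<forall>x\<in>carrier M. \<forall>y\<in>carrier M. add M x y = add M y x) \<and>
    (\<forall>x\<in>carrier M. add M (zero M) x = x) \<and>
    (\<forall>x\<in>carrier M. sub M x x = zero M) \<and>
    (\<forall>x\<in>carrier M. smul M 1 x = x) \<and>
    (\<forall>x\<in>carrier M. \<forall>c d. smul M c (smul M d x) = smul M (c * d) x) \<and>
    (\<forall>x\<in>carrier M. \<forall>c d. smul M (c + d) x = add M (smul M c x) (smul M d x)) \<and>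
    (\<forall>x\<in>carrier M. \<forall>y\<in>carrier M. \<forall>c.
      smul M c (add M x y) = add M (smul M c x) (smul M c y)) \<and>
    (\<forall>x\<in>carrier M. \<forall>y\<in>carrier M. \<forall>a. act M (add M x y) a = add M (act M x a) (act M y a)) \<and>
    (\<forall>x\<in>carrier M. \<forall>a b. act M x (a + b) = add M (act M x a) (act M x b)) \<and>
    (\<forall>x\<in>carrier M. \<forall>a b. act M x (a * b) = act M (act M x a) b) \<and>
    (\<forall>x\<in>carrier M. \<forall>c a. act M (smul M c x) a = smul M c (act M x a) \<and>
      act M x (c *\<^sub>C a) = smul M c (act M x a)) \<and>
    (\<forall>x\<in>carrier M. \<forall>y\<in>carrier M. \<forall>z\<in>carrier M.
      ip M x (add M y z) = ip M x y + ip M x z) \<and>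
    (\<forall>x\<in>carrier M. \<forall>y\<in>carrier M. \<forall>c. ip M x (smul M c y) = c *\<^sub>C ip M x y) \<and>
    (\<forall>x\<in>carrier M. \<forall>y\<in>carrier M. \<forall>a. ip M x (act M y a) = ip M x y * a) \<and>
    (\<forall>x\<in>carrier M. \<forall>y\<in>carrier M. ip M y x = star (ip M x y)) \<and>
    (\<forall>x\<in>carrier M. positive (ip M x x)) \<and>
    (\<forall>x\<in>carrier M. ip M x x = 0 \<longrightarrow> x = zero M) \<and>
    (\<forall>X. cauchy_in M X \<longrightarrow>
      (\<exists>x\<in>carrier M. (\<lambda>n. seminorm M (sub M (X n) x)) \<longlonglongrightarrow> 0))"

text \<open>A Hilbert space is a Hilbert module over the complex numbers; the right action then
  coincides with scalar multiplication.\<close>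

abbreviation hilbert_space :: "(complex, 'h) ip_module \<Rightarrow> bool"
  where "hilbert_space \<equiv> hilbert_module"

text \<open>Separation and completion in one step: Cauchy sequences for the seminorm of the form,
  modulo sequences converging to zero in that seminorm.\<close>

definition cauchy_rel :: "('a::cstar_algebra, 'e) ip_module \<Rightarrow> ((nat \<Rightarrow> 'e) \<times> (nat \<Rightarrow> 'e)) set"
  where "cauchy_rel M = {(X, Y). cauchy_in M X \<and> cauchy_in M Y \<and>
    (\<lambda>n. seminorm M (sub M (X n) (Y n))) \<longlonglongrightarrow> 0}"

definition cauchy_class :: "('a::cstar_algebra, 'e) ip_module \<Rightarrow> (nat \<Rightarrow> 'e) \<Rightarrow> (nat \<Rightarrow> 'e) set"
  where "cauchy_class M X = cauchy_rel M `` {X}"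

definition representative :: "(nat \<Rightarrow> 'e) set \<Rightarrow> nat \<Rightarrow> 'e"
  where "representative P = (SOME X. X \<in> P)"

definition completion ::
    "('a::cstar_algebra, 'e) ip_module \<Rightarrow> ('a, (nat \<Rightarrow> 'e) set) ip_module"
  where "completion M =
    \<lparr> carrier = {X. cauchy_in M X} // cauchy_rel M,
      zero = cauchy_class M (\<lambda>n. zero M),
      add = (\<lambda>P Q. cauchy_class M (\<lambda>n. add M (representative P n) (representative Q n))),
      smul = (\<lambda>c P. cauchy_class M (\<lambda>n. smul M c (representative P n))),
      act = (\<lambda>P a. cauchy_class M (\<lambda>n. act M (representative P n) a)),
      ip = (\<lambda>P Q. lim (\<lambda>n. ip M (representative P n) (representative Q n))) \<rparr>"


section \<open>Tensor products with the algebra as Hilbert modules\<close>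

text \<open>\<open>formal_tensors V k\<close> is the free complex vector space on the symbols \<open>v \<otimes> b\<close> (\<open>v \<in> V\<close>, \<open>b\<close> in
  the algebra), with the algebra acting on the second factor and with the sesquilinear extension
  of the kernel \<open>k\<close>. Both kernels used below are sesquilinear in each leg (the first one for linear \<open>\<Delta>\<close>), so the relations
  defining the algebraic tensor product lie in the null space of the form. Separation therefore
  imposes them, and \<open>tensor_module V k\<close> is the Hilbert module obtained from the algebraic
  tensor product.\<close>

definition formal_tensors ::
    "'v set \<Rightarrow> ('v \<times> 'a \<Rightarrow> 'v \<times> 'a \<Rightarrow> 'a::cstar_algebra) \<Rightarrow>
      ('a, ('v \<times> 'a) \<Rightarrow>\<^sub>0 complex) ip_module"
  where "formal_tensors V k =
    \<lparr> carrier = {f. Poly_Mapping.keys f \<subseteq> V \<times> UNIV},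
      zero = 0,
      add = (+),
      smul = (\<lambda>c f. Poly_Mapping.map (\<lambda>z. c * z) f),
      act = (\<lambda>f a. \<Sum>p\<in>Poly_Mapping.keys f.
        Poly_Mapping.single (fst p, snd p * a) (Poly_Mapping.lookup f p)),
      ip = (\<lambda>f g. \<Sum>p\<in>Poly_Mapping.keys f. \<Sum>q\<in>Poly_Mapping.keys g.
        (cnj (Poly_Mapping.lookup f p) * Poly_Mapping.lookup g q) *\<^sub>C k p q) \<rparr>"

definition tensor_module ::
    "'v set \<Rightarrow> ('v \<times> 'a \<Rightarrow> 'v \<times> 'a \<Rightarrow> 'a::cstar_algebra) \<Rightarrow>
      ('a, (nat \<Rightarrow> ('v \<times> 'a) \<Rightarrow>\<^sub>0 complex) set) ip_module"
  where "tensor_module V k = completion (formal_tensors V k)"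

definition generator_form :: "('a::cstar_algebra \<Rightarrow> 'a) \<Rightarrow> 'a \<times> 'a \<Rightarrow> 'a \<times> 'a \<Rightarrow> 'a"
  where "generator_form \<Delta> = (\<lambda>(a, b) (c, d).
    star b * (star a * \<Delta> c + \<Delta> (star a) * c - \<Delta> (star a * c)) * d)"

definition standard_form ::
    "(complex, 'h) ip_module \<Rightarrow> 'h \<times> 'a \<Rightarrow> 'h \<times> 'a \<Rightarrow> 'a::cstar_algebra"
  where "standard_form H = (\<lambda>(\<xi>, b) (\<eta>, d). ip H \<xi> \<eta> *\<^sub>C (star b * d))"

definition module_isometry ::
    "('a::cstar_algebra, 'e) ip_module \<Rightarrow> ('a, 'f) ip_module \<Rightarrow> ('e \<Rightarrow> 'f) \<Rightarrow> bool"
  where "module_isometry E F W \<longleftrightarrow>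
    (\<forall>x\<in>carrier E. W x \<in> carrier F) \<and>
    (\<forall>x\<in>carrier E. \<forall>y\<in>carrier E. W (add E x y) = add F (W x) (W y)) \<and>
    (\<forall>x\<in>carrier E. \<forall>c. W (smul E c x) = smul F c (W x)) \<and>
    (\<forall>x\<in>carrier E. \<forall>a. W (act E x a) = act F (W x) a) \<and>
    (\<forall>x\<in>carrier E. \<forall>y\<in>carrier E. ip F (W x) (W y) = ip E x y)"

text \<open>The Hilbert space is quantified over carriers inside the type \<open>'a \<Rightarrow> complex\<close>. This loses
  no generality. Each element of the standard module lies in \<open>K \<otimes> A\<close> for a separable subspace \<open>K\<close>,
  so the range of \<open>W\<close> lies in \<open>K \<otimes> A\<close> for a closed subspace \<open>K\<close> of Hilbert dimension at most the
  cardinality of \<open>A\<close> (if \<open>A\<close> is nonzero, hence infinite). Such a \<open>K\<close> is isomorphic to a subspace of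
  \<open>\<ell>\<^sup>2(A)\<close>, whose elements are functions \<open>'a \<Rightarrow> complex\<close>.\<close>

definition strongly_local ::
    "(real \<Rightarrow> 'a::cstar_algebra \<Rightarrow> 'a) \<Rightarrow> ('a \<Rightarrow> 'a) \<Rightarrow> bool"
  where "strongly_local \<Phi> \<Delta> \<longleftrightarrow>
    cp_markov_semigroup \<Phi> \<and> is_generator \<Phi> \<Delta> \<and>
    (\<exists>(H :: (complex, 'a \<Rightarrow> complex) ip_module) W.
      hilbert_space H \<and>
      module_isometry (tensor_module UNIV (generator_form \<Delta>))
        (tensor_module (carrier H) (standard_form H)) W)"

end

theory Submission
  imports Defs
begin

text \<open>For a normal \<open>u\<close> the generator \<open>x \<mapsto> [u\<^sup>*, [u, x]]\<close> equals \<open>u\<^sup>*u x + x u\<^sup>*u - (u\<^sup>* x u + u x u\<^sup>*)\<close>, so its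
  carre du champ at \<open>(a, c)\<close> is \<open>[u, a]\<^sup>* [u, c] + [u\<^sup>*, a]\<^sup>* [u\<^sup>*, c]\<close>. Hence
  \<open>a \<otimes> b \<mapsto> \<Sum>\<^sub>V e\<^sub>V \<otimes> [V, a] b\<close>, with \<open>V\<close> running through the \<open>U\<^sub>j\<close> and \<open>U\<^sub>j\<^sup>*\<close>, is isometric into
  \<open>\<complex>\<^sup>2\<^sup>n \<otimes> A\<close>. Since all \<open>U\<^sub>j, U\<^sub>j\<^sup>*\<close> commute, the left multiplications, right multiplications and jump terms
  that make up \<open>\<Delta>\<close> commute as operators, and \<open>e\<^sup>-\<^sup>t\<^sup>\<Delta>\<close> factors into \<open>x \<mapsto> e\<^sup>-\<^sup>t\<^sup>G x e\<^sup>-\<^sup>t\<^sup>G\<close>,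
  \<open>G = \<Sum> U\<^sub>j\<^sup>*U\<^sub>j\<close>, followed by a power series with nonnegative coefficients in the completely positive
  jump map. Contractivity follows from the Kadison--Schwarz inequality in a unitization.\<close>

section \<open>The positive cone of a unital C*-algebra\<close>

text \<open>Positivity means being of the form \<open>star y * y\<close> in an algebra that may lack
  a unit. The first obstacle is to show that such elements are closed under sums and limits and that
  the norm is monotone on them: this carries complete positivity through power series and controls
  coordinates in the tensor modules. Spectral theory is avoided; the only analytic tool is a square
  root commuting with everything that commutes with the given element. A unit is adjoined because
  the contraction argument compares with \<open>1\<close>; commutators annihilate the adjoined unit,
  so the extended semigroup fixes it. On the module side both forms are finite sums of
  \<open>star (\<theta> s x) * \<theta> s y\<close>, so elements of the completions are determined
  by limits of finitely many coordinates and the isometry only has to match coordinates. The Hilbert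
  space must consist of functions on the algebra, so its 2n basis vectors are indexed by 2n elements
  of the algebra; they exist because a noncommutative algebra is nonzero, hence infinite.\<close>

lemma scaleC_one [simp]: "1 *\<^sub>C (x :: 'a::cstar_algebra) = x"
  using scaleC_of_real[of 1 x] by simp

lemma scaleC_zero_left [simp]: "0 *\<^sub>C (x :: 'a::cstar_algebra) = 0"
  using scaleC_of_real[of 0 x] by simp

lemma scaleC_minus_one: "(- 1) *\<^sub>C (x :: 'a::cstar_algebra) = - x"
  using scaleC_of_real[of "- 1" x] by simp

lemma scaleC_minus_left: "(- c) *\<^sub>C (x :: 'a::cstar_algebra) = - (c *\<^sub>C x)"
  using scaleC_scaleC[of "- 1" c x] by (simp add: scaleC_minus_one)

lemma scaleC_zero_right [simp]: "c *\<^sub>C (0 :: 'a::cstar_algebra) = 0"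
  using scaleC_add_right[of c 0 "0 :: 'a"] by simp

lemma scaleC_minus_right: "c *\<^sub>C (- x) = - (c *\<^sub>C (x :: 'a::cstar_algebra))"
  using scaleC_add_right[of c x "- x"] by (simp add: eq_neg_iff_add_eq_0 add.commute)

lemma scaleC_diff_right: "c *\<^sub>C (x - y) = c *\<^sub>C (x :: 'a::cstar_algebra) - c *\<^sub>C y"
  using scaleC_add_right[of c x "- y"] by (simp add: scaleC_minus_right)

lemma scaleC_sum_right: "c *\<^sub>C (\<Sum>i\<in>I. f i) = (\<Sum>i\<in>I. c *\<^sub>C (f i :: 'a::cstar_algebra))"
  by (induction I rule: infinite_finite_induct) (auto simp: scaleC_add_right)

lemma scaleC_scaleR: "c *\<^sub>C (r *\<^sub>R x) = r *\<^sub>R (c *\<^sub>C (x :: 'a::cstar_algebra))"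
  unfolding scaleC_of_real[symmetric] scaleC_scaleC by (simp add: mult.commute)

lemma bounded_linear_scaleC: "bounded_linear ((*\<^sub>C) c :: 'a::cstar_algebra \<Rightarrow> 'a)"
  by (rule bounded_linear_intro[of _ "cmod c"])
    (auto simp: scaleC_add_right scaleC_scaleR norm_scaleC)

lemma star_zero [simp]: "star (0 :: 'a::cstar_algebra) = 0"
  using star_add[of 0 "0 :: 'a"] by simp

lemma star_minus: "star (- x) = - star (x :: 'a::cstar_algebra)"
  using star_add[of x "- x"] by (simp add: eq_neg_iff_add_eq_0 add.commute)

lemma star_diff: "star (x - y) = star (x :: 'a::cstar_algebra) - star y"
  using star_add[of x "- y"] by (simp add: star_minus)

lemma star_sum: "star (\<Sum>i\<in>I. f i) = (\<Sum>i\<in>I. star (f i :: 'a::cstar_algebra))"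
  by (induction I rule: infinite_finite_induct) (auto simp: star_add)

lemma star_scaleR: "star (r *\<^sub>R x) = r *\<^sub>R star (x :: 'a::cstar_algebra)"
  unfolding scaleC_of_real[symmetric] by (simp add: star_scaleC)

lemma norm_star [simp]: "norm (star x) = norm (x :: 'a::cstar_algebra)"
proof -
  have le: "norm y \<le> norm (star y)" for y :: 'a
  proof (cases "y = 0")
    case False
    have "norm y * norm y \<le> norm (star y) * norm y"
      using cstar_identity[of y] norm_mult_ineq[of "star y" y] by (simp add: power2_eq_square)
    with False show ?thesis by simp
  qed simp
  show ?thesis using le[of x] le[of "star x"] by (simp add: star_star)
qed

lemma bounded_linear_star: "bounded_linear (star :: 'a::cstar_algebra \<Rightarrow> 'a)"
  by (rule bounded_linear_intro[of _ 1]) (auto simp: star_add star_scaleR)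

lemmas cstar_simps = scaleC_add_right scaleC_add_left scaleC_minus_left scaleC_minus_right
  scaleC_diff_right scaleC_scaleC mult_scaleC_left mult_scaleC_right
  star_add star_minus star_diff star_scaleC star_scaleR star_mult star_star

lemma star_one [simp]: "star (1 :: 'a::{cstar_algebra, real_normed_algebra_1}) = 1"
  by (metis mult.left_neutral mult.right_neutral star_mult star_star)

lemma star_of_real [simp]: "star (of_real r :: 'a::{cstar_algebra, real_normed_algebra_1}) = of_real r"
  by (simp add: of_real_def star_scaleR)

lemma norm_self_adjoint_power2:
  "star h = h \<Longrightarrow> norm (h\<^sup>2) = (norm (h :: 'a::{cstar_algebra, real_normed_algebra_1}))\<^sup>2"
  using cstar_identity[of h] by (simp add: power2_eq_square)

text \<open>The square root is \<open>1 - y\<close> where \<open>y\<close> is the limit of the iteration \<open>y \<mapsto> (z + y\<^sup>2) / 2\<close>,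
  which is dominated by the same iteration for the number \<open>z = 1\<close>.\<close>

lemma sqrt_one_minus:
  fixes z :: "'a::{cstar_algebra, real_normed_algebra_1}"
  assumes z: "norm z \<le> 1" "star z = z"
  shows "\<exists>y. norm y \<le> 1 \<and> star y = y \<and> (1 - y)\<^sup>2 = 1 - z \<and> (\<forall>x. x * z = z * x \<longrightarrow> x * y = y * x)"
proof -
  define Y where "Y = rec_nat (0::'a) (\<lambda>_ y. (1/2) *\<^sub>R (z + y\<^sup>2))"
  define R where "R = rec_nat (0::real) (\<lambda>_ r. (1/2) * (1 + r\<^sup>2))"
  have Y0: "Y 0 = 0" and YS: "\<And>k. Y (Suc k) = (1/2) *\<^sub>R (z + (Y k)\<^sup>2)"
    by (auto simp: Y_def)
  have R0: "R 0 = 0" and RS: "\<And>k. R (Suc k) = (1/2) * (1 + (R k)\<^sup>2)"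
    by (auto simp: R_def)
  have R: "0 \<le> R k \<and> R k \<le> 1" for k
    by (induction k) (auto simp: R0 RS power_le_one_iff)
  \<comment> \<open>Twice the increment is \<open>(R k - 1)^2\<close>.\<close>
  have Rmono: "R k \<le> R (Suc k)" for k
    using zero_le_power2[of "R k - 1"] by (simp add: RS power2_eq_square algebra_simps)
  have comm: "x * z = z * x \<Longrightarrow> x * Y k = Y k * x" for x k
  proof (induction k)
    case (Suc k)
    have "x * (Y k)\<^sup>2 = (Y k)\<^sup>2 * x"
      using Suc by (metis mult.assoc power2_eq_square)
    with Suc show ?case by (simp add: YS distrib_left distrib_right)
  qed (simp add: Y0)
  have sa: "star (Y k) = Y k" for k
    by (induction k) (auto simp: Y0 YS star_scaleR star_add z star_mult power2_eq_square)
  have YR: "norm (Y k) \<le> R k" for k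
  proof (induction k)
    case (Suc k)
    have "norm (z + (Y k)\<^sup>2) \<le> 1 + (R k)\<^sup>2"
      using z Suc norm_power_ineq[of "Y k" 2] power_mono[OF Suc, of 2]
      by (intro norm_triangle_le add_mono) auto
    then show ?case by (simp add: YS RS)
  qed (simp add: Y0 R0)
  \<comment> \<open>The iterates commute, since each commutes with everything that commutes with
    \<open>z\<close>. So an increment is half the product of the previous increment with the sum of
    the two iterates, and the same identity for \<open>R\<close> turns the norm estimate into an
    induction.\<close>
  have step: "norm (Y (Suc k) - Y k) \<le> R (Suc k) - R k" for k
  proof (induction k)
    case (Suc k)
    have "Y (Suc k) * Y k = Y k * Y (Suc k)"
      using comm comm[of z k] by metis
    then have "Y (Suc (Suc k)) - Y (Suc k) = (1/2) *\<^sub>R ((Y (Suc k) - Y k) * (Y (Suc k) + Y k))"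
      by (simp only: YS[of "Suc k"]) (simp add: YS[of k] algebra_simps power2_eq_square flip: scaleR_add_right scaleR_diff_right)
    also have "norm \<dots> \<le> (1/2) * ((R (Suc k) - R k) * (R (Suc k) + R k))"
      using Suc YR[of k] YR[of "Suc k"] Rmono[of k] norm_triangle_ineq[of "Y (Suc k)" "Y k"]
      by (simp, intro order_trans[OF norm_mult_ineq] mult_mono) auto
    also have "\<dots> = R (Suc (Suc k)) - R (Suc k)"
      by (simp only: RS[of "Suc k"]) (simp add: RS[of k] algebra_simps power2_eq_square)
    finally show ?case .
  qed (use z in \<open>simp add: Y0 R0 YS RS\<close>)
  \<comment> \<open>Telescoping; convergence of the bounded increasing \<open>R\<close> then makes
    \<open>Y\<close> Cauchy.\<close>
  have dist: "norm (Y (m + k) - Y k) \<le> R (m + k) - R k" for m k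
  proof (induction m)
    case (Suc m)
    have "norm (Y (Suc m + k) - Y k) \<le> norm (Y (Suc (m + k)) - Y (m + k)) + norm (Y (m + k) - Y k)"
      using norm_triangle_ineq[of "Y (Suc (m + k)) - Y (m + k)" "Y (m + k) - Y k"] by simp
    with Suc step[of "m + k"] show ?case by simp
  qed simp
  have "convergent R"
    by (rule Bseq_mono_convergent[OF BseqI'[of _ 1]])
      (use R in \<open>auto intro: Rmono lift_Suc_mono_le\<close>)
  then have CR: "Cauchy R" by (rule convergent_Cauchy)
  have "Cauchy Y"
  proof (rule metric_CauchyI)
    fix e :: real assume "e > 0"
    then obtain N where N: "\<And>m n. m \<ge> N \<Longrightarrow> n \<ge> N \<Longrightarrow> dist (R m) (R n) < e"
      using metric_CauchyD[OF CR] by blast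
    have "dist (Y (m + k)) (Y k) < e" if "k \<ge> N" for m k
      using dist[of m k] N[of "m + k" k] that by (auto simp: dist_norm)
    then have "dist (Y m) (Y n) < e" if "m \<ge> N" "n \<ge> N" for m n
      using that by (metis dist_commute le_add_diff_inverse2 nat_le_linear)
    then show "\<exists>N. \<forall>m\<ge>N. \<forall>n\<ge>N. dist (Y m) (Y n) < e" by blast
  qed
  then obtain y where y: "Y \<longlonglongrightarrow> y"
    using Cauchy_convergent convergent_def by blast
  have "norm y \<le> 1"
    using YR R by (intro LIMSEQ_le_const2[OF tendsto_norm[OF y]]) (meson order_trans)
  moreover have "star y = y"
    using LIMSEQ_unique[OF bounded_linear.tendsto[OF bounded_linear_star y]] y sa by simp
  moreover have "(1 - y)\<^sup>2 = 1 - z"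
  proof -
    have "(\<lambda>k. Y (Suc k)) \<longlonglongrightarrow> (1/2) *\<^sub>R (z + y\<^sup>2)"
      unfolding YS by (intro tendsto_intros y)
    with y have *: "y = (1/2) *\<^sub>R (z + y\<^sup>2)"
      using LIMSEQ_unique LIMSEQ_Suc by blast
    \<comment> \<open>The fixed point equation is \<open>(1 - y)^2 = 1 - z\<close>
      rearranged.\<close>
    have "y + y = z + y\<^sup>2"
      by (subst *, subst (2) *) (simp flip: scaleR_add_left)
    then show ?thesis by (simp add: power2_eq_square algebra_simps)
  qed
  moreover have "x * y = y * x" if "x * z = z * x" for x
    using LIMSEQ_unique[OF tendsto_mult[OF tendsto_const y, of x] ] tendsto_mult[OF y tendsto_const, of x]
      comm[OF that] by simp
  ultimately show ?thesis by blast
qed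

text \<open>The Kelley--Vaught description of the positive cone; by \<open>positive_iff_kv_positive\<close> below it
  agrees with the definition by \<open>y\<^sup>* y\<close>, and it is visibly a convex cone.\<close>

definition kv_positive :: "'a::{cstar_algebra, real_normed_algebra_1} \<Rightarrow> bool"
  where "kv_positive h \<longleftrightarrow> star h = h \<and> (\<exists>t. norm (of_real t - h) \<le> t)"

lemma kv_positive_add: "kv_positive g \<Longrightarrow> kv_positive h \<Longrightarrow> kv_positive (g + h)"
proof -
  assume g: "kv_positive g" and h: "kv_positive h"
  then obtain s t where "norm (of_real s - g) \<le> s" "norm (of_real t - h) \<le> t"
    by (auto simp: kv_positive_def)
  then have "norm (of_real (s + t) - (g + h)) \<le> s + t"
    using norm_triangle_ineq[of "of_real s - g" "of_real t - h"] by (simp add: algebra_simps)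
  with g h show ?thesis unfolding kv_positive_def by (metis star_add)
qed

text \<open>After division by \<open>t\<close> the cone condition says that \<open>1 - h / t\<close>
  has norm at most 1, which is the input of \<open>sqrt_one_minus\<close>. The commutation clause
  replaces functional calculus: later it makes roots of related elements commute.\<close>

lemma kv_positive_sqrt:
  fixes h :: "'a::{cstar_algebra, real_normed_algebra_1}"
  assumes "kv_positive h"
  shows "\<exists>w. kv_positive w \<and> w\<^sup>2 = h \<and> (\<forall>x. x * h = h * x \<longrightarrow> x * w = w * x)"
proof -
  obtain t where t: "norm (of_real t - h) \<le> t" and sa: "star h = h"
    using assms by (auto simp: kv_positive_def)
  show ?thesis
  proof (cases "t > 0")
    \<comment> \<open>A norm is bounded by \<open>t\<close>, so here \<open>t = 0\<close> and
      \<open>h = 0\<close>; the rescaling by \<open>1/t\<close> is only possible in the other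
      case.\<close>
    case False
    then have "t = 0" using t norm_ge_zero order_trans by (metis linorder_not_le nle_le)
    with t have "h = 0" by simp
    then show ?thesis by (intro exI[of _ 0]) (auto simp: kv_positive_def intro: exI[of _ 0])
  next
    case True
    define z where "z = 1 - (1/t) *\<^sub>R h"
    have "z = (1/t) *\<^sub>R (of_real t - h)"
      using True by (simp add: z_def scaleR_diff_right of_real_def)
    then have "norm z = norm (of_real t - h) / t" using True by simp
    with t True have "norm z \<le> 1" by simp
    moreover have "star z = z" by (simp add: z_def star_diff star_scaleR sa)
    ultimately obtain y where y: "norm y \<le> 1" "star y = y" "(1 - y)\<^sup>2 = 1 - z"
      "\<And>x. x * z = z * x \<Longrightarrow> x * y = y * x" using sqrt_one_minus by metis
    define w where "w = sqrt t *\<^sub>R (1 - y)"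
    \<comment> \<open>The root lies in the cone again: its distance to \<open>sqrt t\<close> is
      \<open>sqrt t\<close> times the norm of \<open>y\<close>, which is at most 1.\<close>
    have "norm (of_real (sqrt t) - w) \<le> sqrt t"
    proof -
      have "of_real (sqrt t) - w = sqrt t *\<^sub>R y"
        by (simp add: w_def algebra_simps of_real_def)
      then show ?thesis using y True by (simp add: mult_left_le)
    qed
    then have "kv_positive w"
      using y by (auto simp: kv_positive_def w_def star_scaleR star_diff)
    moreover have "w\<^sup>2 = h"
      using True y(3) by (simp add: w_def power2_eq_square z_def)
    moreover have "x * w = w * x" if "x * h = h * x" for x
    proof -
      have "x * z = z * x" using that by (simp add: z_def algebra_simps)
      from y(4)[OF this] show ?thesis by (simp add: w_def algebra_simps)
    qed
    ultimately show ?thesis by blast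
  qed
qed

text \<open>Here \<open>h + \<i>w\<close> is \<open>\<surd>t\<close> times a unitary.\<close>

lemma norm_le_of_sum_squares:
  fixes h w :: "'a::{cstar_algebra, real_normed_algebra_1}"
  assumes sa: "star h = h" "star w = w" and "h * w = w * h" and sum: "h\<^sup>2 + w\<^sup>2 = of_real t"
    and "0 \<le> t"
  shows "(norm h)\<^sup>2 \<le> t"
proof -
  define u where "u = h + \<i> *\<^sub>C w"
  have su: "star u = h - \<i> *\<^sub>C w" by (simp add: u_def cstar_simps sa)
  have "star u * u = h\<^sup>2 + w\<^sup>2"
    unfolding su using assms(3) by (simp add: u_def algebra_simps cstar_simps power2_eq_square)
  with sum have "(norm u)\<^sup>2 = t"
    using cstar_identity[of u] \<open>0 \<le> t\<close> by simp
  have "h = (1/2) *\<^sub>R (u + star u)"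
    unfolding su by (simp add: u_def flip: scaleR_2)
  then have "norm h \<le> norm u"
    using norm_triangle_ineq[of u "star u"] by simp
  then have "(norm h)\<^sup>2 \<le> (norm u)\<^sup>2" by (intro power_mono) auto
  with \<open>(norm u)\<^sup>2 = t\<close> show ?thesis by simp
qed

text \<open>A self-adjoint root \<open>w\<close> of \<open>t - h^2\<close> comes from
  \<open>sqrt_one_minus\<close>, without presupposing that \<open>h^2\<close> is in the cone. Then
  \<open>w^2 + h^2 = t\<close> bounds \<open>w\<close>, hence \<open>w^2\<close>.\<close>

lemma norm_diff_square_le:
  fixes h :: "'a::{cstar_algebra, real_normed_algebra_1}"
  assumes sa: "star h = h" and t: "norm (h\<^sup>2) \<le> t"
  shows "norm (of_real t - h\<^sup>2) \<le> t"
proof (cases "t = 0")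
  case False
  then have "t > 0" using t norm_ge_zero[of "h\<^sup>2"] by linarith
  define z where "z = (1/t) *\<^sub>R h\<^sup>2"
  have "norm z \<le> 1" using t \<open>t > 0\<close> by (simp add: z_def)
  moreover have "star z = z" by (simp add: z_def cstar_simps sa power2_eq_square)
  ultimately obtain y where y: "star y = y" "(1 - y)\<^sup>2 = 1 - z"
    "\<And>x. x * z = z * x \<Longrightarrow> x * y = y * x" using sqrt_one_minus by metis
  define w where "w = sqrt t *\<^sub>R (1 - y)"
  have w2: "w\<^sup>2 = of_real t - h\<^sup>2"
  proof -
    have "w\<^sup>2 = t *\<^sub>R (1 - y)\<^sup>2" using \<open>t > 0\<close> by (simp add: w_def power2_eq_square)
    also have "\<dots> = of_real t - h\<^sup>2"
      unfolding y(2) using \<open>t > 0\<close> by (simp add: z_def scaleR_diff_right of_real_def)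
    finally show ?thesis .
  qed
  have sw: "star w = w" by (simp add: w_def cstar_simps y)
  have "h * z = z * h" by (simp add: z_def power2_eq_square mult.assoc)
  then have "w * h = h * w" using y(3) by (simp add: w_def algebra_simps)
  then have "(norm w)\<^sup>2 \<le> t"
    using sa sw \<open>t > 0\<close> by (intro norm_le_of_sum_squares[of w h]) (auto simp: w2)
  with norm_self_adjoint_power2[OF sw] show ?thesis by (simp add: w2)
qed (use t in simp)

lemma kv_positive_square: "star h = h \<Longrightarrow> kv_positive (h\<^sup>2)"
  unfolding kv_positive_def using norm_diff_square_le[of h]
  by (auto simp: power2_eq_square star_mult)

text \<open>The existential \<open>t\<close> in \<open>kv_positive\<close> can be any bound of the
  norm, because \<open>h\<close> is the square of a self-adjoint element. This uniform choice is
  what survives limits.\<close>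

lemma kv_positive_norm_diff:
  assumes "kv_positive h" "norm h \<le> t"
  shows "norm (of_real t - h) \<le> t"
proof -
  obtain w where "kv_positive w" "w\<^sup>2 = h" using kv_positive_sqrt[OF assms(1)] by blast
  then show ?thesis using norm_diff_square_le[of w t] assms(2) by (auto simp: kv_positive_def)
qed

lemma kv_positive_LIMSEQ:
  assumes lim: "X \<longlonglongrightarrow> x" and X: "\<And>k. kv_positive (X k)"
  shows "kv_positive x"
proof -
  have "star x = x"
    using LIMSEQ_unique[OF bounded_linear.tendsto[OF bounded_linear_star lim]] lim X
    by (simp add: kv_positive_def)
  moreover have "norm (of_real (norm x) - x) \<le> norm x"
  proof (rule LIMSEQ_le)
    show "(\<lambda>k. norm (of_real (norm (X k)) - X k)) \<longlonglongrightarrow> norm (of_real (norm x) - x)"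
      by (intro tendsto_intros lim)
    show "(\<lambda>k. norm (X k)) \<longlonglongrightarrow> norm x" by (intro tendsto_intros lim)
  qed (use kv_positive_norm_diff[OF X] in auto)
  ultimately show ?thesis by (auto simp: kv_positive_def)
qed

section \<open>Elements of the form \<open>star y * y\<close> lie in the cone\<close>

lemma sum_squares_eq_0:
  fixes v w :: "'a::{cstar_algebra, real_normed_algebra_1}"
  assumes "star v = v" "star w = w" "v * w = w * v" "v\<^sup>2 + w\<^sup>2 = 0"
  shows "v = 0"
  using norm_le_of_sum_squares[of v w 0] assms by simp

text \<open>The roots of \<open>h\<close> and \<open>- h\<close> commute, since the second commutes
  with whatever commutes with \<open>h\<close>, and their squares add up to 0.\<close>

lemma kv_positive_antisym:
  assumes "kv_positive h" "kv_positive (- h)"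
  shows "h = 0"
proof -
  obtain w where w: "kv_positive w" "w\<^sup>2 = h" using kv_positive_sqrt[OF assms(1)] by blast
  obtain v where v: "kv_positive v" "v\<^sup>2 = - h" "\<And>x. x * - h = - h * x \<Longrightarrow> x * v = v * x"
    using kv_positive_sqrt[OF assms(2)] by blast
  have "w * v = v * w"
    by (rule v(3)) (simp add: w(2)[symmetric] power2_eq_square mult.assoc)
  then have "w = 0"
    using v w by (intro sum_squares_eq_0[of w v]) (auto simp: kv_positive_def)
  with w show ?thesis by simp
qed

text \<open>Cartesian decomposition: \<open>a\<close> is twice the real part of \<open>v\<close>,
  \<open>b\<close> is minus twice its imaginary part, and the expression is
  \<open>(a^2 + b^2) / 2\<close>. The mixed terms cancel only in the sum of both orders, so this
  says nothing yet about \<open>star v * v\<close> alone.\<close>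

lemma kv_positive_star_mult_sum:
  fixes v :: "'a::{cstar_algebra, real_normed_algebra_1}"
  shows "kv_positive (star v * v + v * star v)"
proof -
  define a b where "a = v + star v" and "b = \<i> *\<^sub>C (v - star v)"
  have sa: "star a = a" "star b = b"
    by (auto simp: a_def b_def cstar_simps add.commute)
  then have sa': "star ((1 / sqrt 2) *\<^sub>R a) = (1 / sqrt 2) *\<^sub>R a"
     "star ((1 / sqrt 2) *\<^sub>R b) = (1 / sqrt 2) *\<^sub>R b" by (auto simp: star_scaleR)
  have ab: "a\<^sup>2 + b\<^sup>2 = 2 *\<^sub>R (star v * v + v * star v)"
    by (simp add: a_def b_def power2_eq_square cstar_simps algebra_simps scaleR_2)
  have "((1 / sqrt 2) *\<^sub>R a)\<^sup>2 + ((1 / sqrt 2) *\<^sub>R b)\<^sup>2 = (1/2) *\<^sub>R (a\<^sup>2 + b\<^sup>2)"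
    by (simp add: power2_eq_square algebra_simps)
  also have "\<dots> = star v * v + v * star v" by (simp add: ab)
  finally show ?thesis
    using kv_positive_add[OF kv_positive_square[OF sa'(1)] kv_positive_square[OF sa'(2)]] by simp
qed

text \<open>With \<open>f = v v\<^sup>*\<close>, \<open>g = q\<^sup>2 = - v\<^sup>* v\<close> and \<open>u = q v\<^sup>*\<close> one has \<open>u\<^sup>* u + u u\<^sup>* = - f\<^sup>2 - g\<^sup>2\<close>, so that
  \<open>f\<^sup>2 + g\<^sup>2\<close> is both positive and negative.\<close>

lemma star_mult_nonpositive_eq_0:
  fixes v :: "'a::{cstar_algebra, real_normed_algebra_1}"
  assumes "kv_positive (- (star v * v))"
  shows "v = 0"
proof -
  define f g where "f = v * star v" and "g = - (star v * v)"
  obtain q where q: "kv_positive q" "q\<^sup>2 = g" using kv_positive_sqrt assms g_def by blast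
  define u where "u = q * star v"
  have sq: "star q = q" using q by (simp add: kv_positive_def)
  have "star u * u = v * q\<^sup>2 * star v"
    by (simp add: u_def cstar_simps sq power2_eq_square mult.assoc)
  then have uu: "star u * u = - f\<^sup>2"
    unfolding q(2) by (simp add: f_def g_def power2_eq_square mult.assoc)
  have "u * star u = - (q * q\<^sup>2 * q)"
    unfolding q(2) by (simp add: u_def g_def cstar_simps sq mult.assoc)
  also have "q * q\<^sup>2 * q = g\<^sup>2"
    unfolding q(2)[symmetric] by (simp add: power2_eq_square mult.assoc)
  finally have "kv_positive (- (f\<^sup>2 + g\<^sup>2))"
    using kv_positive_star_mult_sum[of u] uu by simp
  moreover have sfg: "star f = f" "star g = g" by (auto simp: f_def g_def cstar_simps)
  then have "kv_positive (f\<^sup>2)" "kv_positive (g\<^sup>2)" by (auto intro: kv_positive_square)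
  then have "kv_positive (f\<^sup>2 + g\<^sup>2)" by (rule kv_positive_add)
  ultimately have *: "f\<^sup>2 + g\<^sup>2 = 0" by (intro kv_positive_antisym)
  then have "f\<^sup>2 = - g\<^sup>2" by (simp add: eq_neg_iff_add_eq_0)
  with \<open>kv_positive (f\<^sup>2)\<close> \<open>kv_positive (g\<^sup>2)\<close> have "g\<^sup>2 = 0"
    by (intro kv_positive_antisym) auto
  then have "norm g = 0" using norm_self_adjoint_power2[OF sfg(2)] by simp
  then show ?thesis using cstar_identity[of v] by (simp add: g_def)
qed

text \<open>Kaplansky's argument. With \<open>k\<close> the absolute value of
  \<open>h = star y * y\<close>, the element \<open>p = k - h\<close> is twice the negative part of
  \<open>h\<close>. Multiplying \<open>y\<close> by \<open>p\<close> isolates that part: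
  \<open>star (y * p) * (y * p)\<close> is minus a square, so \<open>y * p = 0\<close>, which forces
  \<open>p = 0\<close> and \<open>h = k\<close>.\<close>

lemma kv_positive_star_mult:
  fixes y :: "'a::{cstar_algebra, real_normed_algebra_1}"
  shows "kv_positive (star y * y)"
proof -
  define h where "h = star y * y"
  have sh: "star h = h" by (simp add: h_def cstar_simps)
  obtain k where k: "kv_positive k" "k\<^sup>2 = h\<^sup>2" "\<And>x. x * h\<^sup>2 = h\<^sup>2 * x \<Longrightarrow> x * k = k * x"
    using kv_positive_sqrt[OF kv_positive_square[OF sh]] by blast
  have hk: "h * k = k * h" by (rule k(3)) (simp add: power2_eq_square mult.assoc)
  obtain m where m: "kv_positive m" "m\<^sup>2 = k" "\<And>x. x * k = k * x \<Longrightarrow> x * m = m * x"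
    using kv_positive_sqrt[OF k(1)] by blast
  define p where "p = k - h"
  have sk: "star k = k" and sm: "star m = m" using k m by (auto simp: kv_positive_def)
  have sp: "star p = p" by (simp add: p_def star_diff sk sh)
  have "p * k = k * p" by (simp add: p_def algebra_simps hk)
  then have pm: "p * m = m * p" by (rule m(3))
  \<comment> \<open>Since \<open>k^2 = h^2\<close>, the element \<open>h\<close> acts as
    \<open>- k\<close> on \<open>p\<close>.\<close>
  have hp: "h * p = - (k * p)"
    using k(2) by (simp add: p_def algebra_simps hk power2_eq_square)
  have ph: "p * h = - (k * p)" using hp by (simp add: p_def algebra_simps hk)
  have "star (y * p) * (y * p) = p * h * p"
    by (simp add: h_def star_mult sp mult.assoc)
  also have "\<dots> = - (m * m * p * p)"
    unfolding ph m(2)[symmetric] by (simp add: power2_eq_square)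
  also have "m * m * p * p = (m * p)\<^sup>2"
    by (metis pm mult.assoc power2_eq_square)
  finally have "- (star (y * p) * (y * p)) = (m * p)\<^sup>2" by simp
  moreover have "star (m * p) = m * p" by (simp add: star_mult sm sp pm)
  ultimately have "y * p = 0"
    using star_mult_nonpositive_eq_0[of "y * p"] kv_positive_square by metis
  then have "h * p = 0" by (simp add: h_def mult.assoc)
  with hp have "p * p = 0" by (simp add: p_def algebra_simps)
  then have "p = 0" using cstar_identity[of p] by (simp add: sp)
  with k(1) show ?thesis by (simp add: p_def h_def)
qed

lemma positive_iff_kv_positive: "positive x \<longleftrightarrow> kv_positive x"
proof
  assume "kv_positive x"
  then obtain w where "kv_positive w" "w\<^sup>2 = x" using kv_positive_sqrt by blast
  then have "x = star w * w" by (simp add: kv_positive_def power2_eq_square)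
  then show "positive x" unfolding positive_def by blast
qed (auto simp: positive_def kv_positive_star_mult)

text \<open>The roots of \<open>a\<close> and of \<open>t - a\<close> commute and their squares add
  up to \<open>t\<close>, which bounds the first root.\<close>

lemma norm_le_of_kv_positive:
  fixes a :: "'a::{cstar_algebra, real_normed_algebra_1}"
  assumes "kv_positive a" "kv_positive (of_real t - a)" "0 \<le> t"
  shows "norm a \<le> t"
proof -
  obtain w where w: "kv_positive w" "w\<^sup>2 = a" using kv_positive_sqrt[OF assms(1)] by blast
  obtain v where v: "kv_positive v" "v\<^sup>2 = of_real t - a"
    "\<And>x. x * (of_real t - a) = (of_real t - a) * x \<Longrightarrow> x * v = v * x"
    using kv_positive_sqrt[OF assms(2)] by blast
  have "w * (of_real t - a) = (of_real t - a) * w"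
    by (simp add: w(2)[symmetric] power2_eq_square algebra_simps of_real_def)
  then have "w * v = v * w" by (rule v(3))
  then have "(norm w)\<^sup>2 \<le> t"
    using v w assms(3) by (intro norm_le_of_sum_squares[of w v]) (auto simp: kv_positive_def)
  then show ?thesis using norm_self_adjoint_power2[of w] w by (simp add: kv_positive_def)
qed

lemma kv_positive_norm_minus:
  "kv_positive h \<Longrightarrow> norm h \<le> t \<Longrightarrow> kv_positive (of_real t - h)"
  unfolding kv_positive_def by (auto simp: star_diff intro!: exI[of _ t])

lemma kv_positive_norm_mono:
  assumes "kv_positive a" "kv_positive c"
  shows "norm a \<le> norm (a + c)"
proof (rule norm_le_of_kv_positive)
  have "kv_positive (of_real (norm (a + c)) - (a + c))"
    using kv_positive_norm_minus kv_positive_add[OF assms] by blast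
  from kv_positive_add[OF this assms(2)] show "kv_positive (of_real (norm (a + c)) - a)" by simp
qed (use assms in auto)

section \<open>Unitization\<close>

datatype 'a unitization = Unitization (alg: 'a) (scal: complex)

lemma unitization_eq_iff: "x = y \<longleftrightarrow> alg x = alg y \<and> scal x = scal y"
  by (cases x; cases y) auto

text \<open>Left multiplication by an element of the unitization on the original algebra, which is
  an ideal there. Its operator norm is the source of the norm on the unitization.\<close>

definition unitization_op :: "'a::cstar_algebra unitization \<Rightarrow> 'a \<Rightarrow> 'a"
  where "unitization_op x y = alg x * y + scal x *\<^sub>C y"

lemma bounded_linear_unitization_op: "bounded_linear (unitization_op x)"
  unfolding unitization_op_def[abs_def]
  by (intro bounded_linear_add bounded_linear_mult_right bounded_linear_scaleC)

lemma norm_unitization_op: "norm (unitization_op x y) \<le> onorm (unitization_op x) * norm y"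
  by (rule onorm[OF bounded_linear_unitization_op])

lemma scaleC_mult_of_real:
  "(c * complex_of_real r) *\<^sub>C x = r *\<^sub>R (c *\<^sub>C (x :: 'a::cstar_algebra))"
  "(complex_of_real r * c) *\<^sub>C x = r *\<^sub>R (c *\<^sub>C x)"
  by (simp_all add: scaleC_of_real scaleC_scaleR flip: scaleC_scaleC)

text \<open>For unital \<open>'a\<close> the operator part alone would only be a seminorm.\<close>

instantiation unitization :: (cstar_algebra) real_normed_algebra_1
begin

definition "(0 :: 'a unitization) = Unitization 0 0"
definition "(1 :: 'a unitization) = Unitization 0 1"
definition "(x :: 'a unitization) + y = Unitization (alg x + alg y) (scal x + scal y)"
definition "(x :: 'a unitization) - y = Unitization (alg x - alg y) (scal x - scal y)"
definition "- (x :: 'a unitization) = Unitization (- alg x) (- scal x)"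
definition "(x :: 'a unitization) * y =
  Unitization (alg x * alg y + scal x *\<^sub>C alg y + scal y *\<^sub>C alg x) (scal x * scal y)"
definition "r *\<^sub>R (x :: 'a unitization) = Unitization (r *\<^sub>R alg x) (r *\<^sub>R scal x)"
definition "norm (x :: 'a unitization) = max (onorm (unitization_op x)) (cmod (scal x))"
definition "sgn (x :: 'a unitization) = inverse (norm x) *\<^sub>R x"
definition "dist (x :: 'a unitization) y = norm (x - y)"
definition "uniformity = (INF e\<in>{0<..}. principal {(x, y :: 'a unitization). dist x y < e})"
definition "open (S :: 'a unitization set) \<longleftrightarrow> (\<forall>x\<in>S. \<forall>\<^sub>F (x', y) in uniformity. x' = x \<longrightarrow> y \<in> S)"

lemma unitization_sel [simp]:
  "alg 0 = 0" "scal 0 = 0" "alg 1 = 0" "scal 1 = 1"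
  "alg (x + y) = alg x + alg y" "scal (x + y) = scal x + scal y"
  "alg (x - y) = alg x - alg y" "scal (x - y) = scal x - scal y"
  "alg (- x) = - alg x" "scal (- x) = - scal x"
  "alg (x * y) = alg x * alg y + scal x *\<^sub>C alg y + scal y *\<^sub>C alg x"
  "scal (x * y) = scal x * scal y"
  "alg (r *\<^sub>R x) = r *\<^sub>R alg x" "scal (r *\<^sub>R x) = r *\<^sub>R scal x"
  by (auto simp: zero_unitization_def one_unitization_def plus_unitization_def
    minus_unitization_def uminus_unitization_def times_unitization_def
    scaleR_unitization_def)

lemma unitization_op_add: "unitization_op (x + y) = (\<lambda>z. unitization_op x z + unitization_op y z)"
  by (auto simp: unitization_op_def algebra_simps cstar_simps)

lemma unitization_op_mult: "unitization_op (x * y) = unitization_op x \<circ> unitization_op y"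
  by (auto simp: unitization_op_def algebra_simps cstar_simps)

lemma unitization_op_scaleR: "unitization_op (r *\<^sub>R x) = (\<lambda>z. r *\<^sub>R unitization_op x z)"
proof
  fix z :: 'a
  have "(r *\<^sub>R scal x) *\<^sub>C z = r *\<^sub>R (scal x *\<^sub>C z)"
    by (simp add: scaleR_conv_of_real scaleC_of_real flip: scaleC_scaleC)
  then show "unitization_op (r *\<^sub>R x) z = r *\<^sub>R unitization_op x z"
    by (simp add: unitization_op_def scaleR_add_right)
qed

lemma norm_scal_le: "cmod (scal x) \<le> norm x"
  by (simp add: norm_unitization_def)

text \<open>Applying the operator to \<open>star (alg x)\<close> recovers the norm of
  \<open>alg x\<close> up to the scalar part; operator and scalar part each contribute at most
  \<open>norm x\<close>, whence the 2. The bound yields definiteness of the norm and, via continuity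
  of \<open>alg\<close>, completeness.\<close>

lemma norm_alg_le: "norm (alg x) \<le> 2 * norm (x :: 'a unitization)"
proof (cases "alg x = 0")
  case False
  let ?y = "star (alg x)"
  have "norm (alg x) * norm (alg x) = norm (alg x * ?y)"
    using cstar_identity[of ?y] by (simp add: star_star power2_eq_square)
  also have "\<dots> = norm (unitization_op x ?y - scal x *\<^sub>C ?y)"
    by (simp add: unitization_op_def)
  also have "\<dots> \<le> onorm (unitization_op x) * norm ?y + cmod (scal x) * norm ?y"
    by (intro order_trans[OF norm_triangle_ineq4] add_mono norm_unitization_op) (simp add: norm_scaleC)
  also have "\<dots> \<le> norm x * norm ?y + norm x * norm ?y"
    by (intro add_mono mult_right_mono) (auto simp: norm_unitization_def)
  finally show ?thesis using False by (simp flip: distrib_right mult_2)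
qed (simp add: norm_unitization_def le_max_iff_disj)

lemma norm_unitization_le: "norm (x :: 'a unitization) \<le> norm (alg x) + cmod (scal x)"
proof -
  have "norm (unitization_op x y) \<le> (norm (alg x) + cmod (scal x)) * norm y" for y
    unfolding unitization_op_def distrib_right
    by (intro order_trans[OF norm_triangle_ineq] add_mono norm_mult_ineq) (simp add: norm_scaleC)
  then show ?thesis by (auto simp: norm_unitization_def intro: onorm_bound)
qed

instance
proof
  fix x y :: "'a unitization" and r :: real
  have onorm_pos: "0 \<le> onorm (unitization_op x)" for x :: "'a unitization"
    by (rule onorm_pos_le[OF bounded_linear_unitization_op])
  show "norm (x + y) \<le> norm x + norm y"
    unfolding norm_unitization_def unitization_op_add
    using onorm_triangle[OF bounded_linear_unitization_op bounded_linear_unitization_op, of x y]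
      norm_triangle_ineq[of "scal x" "scal y"] by (simp add: max_def)
  show "norm (r *\<^sub>R x) = \<bar>r\<bar> * norm x"
    unfolding norm_unitization_def unitization_op_scaleR onorm_scaleR[OF bounded_linear_unitization_op]
    by (simp add: max_mult_distrib_left)
  show "norm (x * y) \<le> norm x * norm y"
  proof -
    have "onorm (unitization_op (x * y)) \<le> onorm (unitization_op x) * onorm (unitization_op y)"
      unfolding unitization_op_mult by (intro onorm_compose bounded_linear_unitization_op)
    also have "\<dots> \<le> norm x * norm y"
      by (intro mult_mono) (auto simp: norm_unitization_def onorm_pos le_max_iff_disj)
    finally have "onorm (unitization_op (x * y)) \<le> norm x * norm y" .
    moreover have "cmod (scal (x * y)) \<le> norm x * norm y"
      unfolding unitization_sel norm_mult
      by (intro mult_mono) (auto simp: norm_unitization_def le_max_iff_disj)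
    ultimately show ?thesis unfolding norm_unitization_def[of "x * y"] by simp
  qed
  show "norm x = 0 \<longleftrightarrow> x = 0"
    using norm_alg_le[of x] norm_scal_le[of x] norm_unitization_le[of x]
    by (auto simp: unitization_eq_iff)
  show "norm (1 :: 'a unitization) = 1"
  proof -
    have "onorm (unitization_op (1 :: 'a unitization)) \<le> 1"
      by (rule onorm_bound) (auto simp: unitization_op_def)
    then show ?thesis by (simp add: norm_unitization_def)
  qed
qed (auto simp: unitization_eq_iff algebra_simps cstar_simps scaleR_conv_of_real
    dist_unitization_def sgn_unitization_def uniformity_unitization_def open_unitization_def
    scaleC_of_real scaleC_scaleR scaleC_mult_of_real)

end

lemma bounded_linear_alg: "bounded_linear alg"
  by (rule bounded_linear_intro[of _ 2]) (use norm_alg_le in \<open>auto simp: mult.commute\<close>)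

lemma bounded_linear_scal: "bounded_linear scal"
  by (rule bounded_linear_intro[of _ 1]) (use norm_scal_le in auto)

instance unitization :: (cstar_algebra) banach
proof
  fix X :: "nat \<Rightarrow> 'a unitization"
  assume X: "Cauchy X"
  have "Cauchy (\<lambda>k. alg (X k))"
    using bounded_linear_alg X by (rule bounded_linear.Cauchy)
  moreover have "Cauchy (\<lambda>k. scal (X k))"
    using bounded_linear_scal X by (rule bounded_linear.Cauchy)
  ultimately obtain a c where "(\<lambda>k. alg (X k)) \<longlonglongrightarrow> a" "(\<lambda>k. scal (X k)) \<longlonglongrightarrow> c"
    using Cauchy_convergent convergent_def by metis
  then have "(\<lambda>k. norm (alg (X k - Unitization a c)) + cmod (scal (X k - Unitization a c))) \<longlonglongrightarrow> 0"
    by (auto intro!: tendsto_add_zero tendsto_norm_zero simp: LIM_zero_iff)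
  moreover have "\<forall>\<^sub>F k in sequentially. norm (X k - Unitization a c)
      \<le> norm (alg (X k - Unitization a c)) + cmod (scal (X k - Unitization a c))"
    by (rule always_eventually) (rule allI, rule norm_unitization_le)
  ultimately have "(\<lambda>k. X k - Unitization a c) \<longlonglongrightarrow> 0"
    by (rule Lim_null_comparison[rotated])
  then show "convergent X" by (auto simp: convergent_def LIM_zero_iff)
qed

instantiation unitization :: (cstar_algebra) cstar_algebra
begin

definition "c *\<^sub>C (x :: 'a unitization) = Unitization (c *\<^sub>C alg x) (c * scal x)"
definition "star (x :: 'a unitization) = Unitization (star (alg x)) (cnj (scal x))"

lemma unitization_star_sel [simp]:
  "alg (c *\<^sub>C x) = c *\<^sub>C alg x" "scal (c *\<^sub>C x) = c * scal x"
  "alg (star x) = star (alg x)" "scal (star x) = cnj (scal x)"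
  by (auto simp: scaleC_unitization_def star_unitization_def)

lemma unitization_op_star: "star (unitization_op x y) * z = star y * unitization_op (star x) z"
  by (simp add: unitization_op_def algebra_simps cstar_simps)

text \<open>The identity in the original algebra gives
  \<open>norm (x y)^2 = norm (star y * (star x * x) y)\<close>, so the squared operator norm of
  \<open>x\<close> is at most that of \<open>star x * x\<close>. Submultiplicativity and invariance
  under \<open>star\<close> give the converse, and the maximum with the scalar part inherits the
  identity.\<close>

lemma norm_star_mult_unitization: "norm (star x * x) = (norm (x :: 'a unitization))\<^sup>2"
proof -
  let ?n = "\<lambda>x :: 'a unitization. onorm (unitization_op x)"
  have pos: "0 \<le> ?n x" for x by (rule onorm_pos_le[OF bounded_linear_unitization_op])
  have sq: "(?n x)\<^sup>2 \<le> ?n (star x * x)" for x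
  proof -
    have "norm (unitization_op x y) \<le> sqrt (?n (star x * x)) * norm y" for y
    proof -
      have "(norm (unitization_op x y))\<^sup>2 = norm (star y * unitization_op (star x * x) y)"
        by (simp add: unitization_op_mult flip: cstar_identity unitization_op_star)
      also have "\<dots> \<le> norm y * (?n (star x * x) * norm y)"
        by (rule order_trans[OF norm_mult_ineq])
          (auto intro!: mult_left_mono norm_unitization_op)
      also have "\<dots> = (sqrt (?n (star x * x)) * norm y)\<^sup>2"
        by (simp add: pos power_mult_distrib power2_eq_square)
      finally show ?thesis by (rule power2_le_imp_le) (simp add: pos)
    qed
    then have "?n x \<le> sqrt (?n (star x * x))" by (intro onorm_bound) (auto simp: pos)
    from power_mono[OF this pos, of 2] show ?thesis by (simp add: pos)
  qed
  have mult: "?n (x * y) \<le> ?n x * ?n y" for x y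
    unfolding unitization_op_mult by (intro onorm_compose bounded_linear_unitization_op)
  have star_ge: "?n x \<le> ?n (star x)" for x
  proof (cases "?n x = 0")
    case False
    have "?n x * ?n x \<le> ?n (star x) * ?n x"
      using order_trans[OF sq mult] by (simp add: power2_eq_square)
    with False pos[of x] show ?thesis by simp
  qed (simp add: pos)
  have "star (star x) = x" by (simp add: unitization_eq_iff star_star)
  then have "?n (star x) = ?n x" using star_ge[of x] star_ge[of "star x"] by simp
  then have "?n (star x * x) = (?n x)\<^sup>2"
    using sq[of x] mult[of "star x" x] by (simp add: power2_eq_square)
  then show ?thesis
    using pos[of x] power_mono_iff[of "?n x" "cmod (scal x)" 2] power_mono_iff[of "cmod (scal x)" "?n x" 2]
    by (auto simp: norm_unitization_def norm_mult max_def power2_eq_square[of "cmod (scal x)"])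
qed

instance
proof
  fix x :: "'a unitization" and c :: complex
  have onorm_pos: "0 \<le> onorm (unitization_op x)" for x :: "'a unitization"
    by (rule onorm_pos_le[OF bounded_linear_unitization_op])
  show "norm (c *\<^sub>C x) = cmod c * norm x"
  proof -
    have op_le: "onorm (unitization_op (d *\<^sub>C y)) \<le> cmod d * onorm (unitization_op y)" for d and y :: "'a unitization"
    proof (rule onorm_bound)
      fix z
      have "unitization_op (d *\<^sub>C y) z = d *\<^sub>C unitization_op y z"
        by (simp add: unitization_op_def cstar_simps)
      then show "norm (unitization_op (d *\<^sub>C y) z) \<le> cmod d * onorm (unitization_op y) * norm z"
        by (simp add: norm_scaleC norm_unitization_op mult.assoc mult_left_mono)
    qed (simp add: onorm_pos)
    have le: "norm (d *\<^sub>C y) \<le> cmod d * norm y" for d and y :: "'a unitization"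
    proof -
      have "norm (d *\<^sub>C y) \<le> max (cmod d * onorm (unitization_op y)) (cmod d * cmod (scal y))"
        unfolding norm_unitization_def by (intro max.mono op_le) (simp add: norm_mult)
      then show ?thesis by (simp add: norm_unitization_def max_mult_distrib_left)
    qed
    show ?thesis
    proof (cases "c = 0")
      case False
      then have "inverse c *\<^sub>C c *\<^sub>C x = x"
        by (simp add: unitization_eq_iff scaleC_scaleC flip: mult.assoc)
      then have "norm x \<le> inverse (cmod c) * norm (c *\<^sub>C x)"
        using le[of "inverse c" "c *\<^sub>C x"] by (simp add: norm_inverse)
      with False le[of c x] show ?thesis by (simp add: field_simps)
    next
      case True
      then show ?thesis
        using le[of 0 x] order_trans[OF norm_ge_zero norm_scal_le, of "0 *\<^sub>C x"] by simp
    qed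
  qed
  show "norm (star x * x) = (norm x)\<^sup>2" by (rule norm_star_mult_unitization)
qed (auto simp: unitization_eq_iff algebra_simps cstar_simps scaleR_conv_of_real[where 'a=complex] scaleC_of_real)

end

definition unitize :: "'a::cstar_algebra \<Rightarrow> 'a unitization"
  where "unitize a = Unitization a 0"

lemma unitize_sel [simp]: "alg (unitize a) = a" "scal (unitize a) = 0"
  by (simp_all add: unitize_def)

lemma unitize_eq_iff [simp]: "unitize a = unitize b \<longleftrightarrow> a = b"
  by (simp add: unitization_eq_iff)

lemma unitize_hom:
  "unitize 0 = 0" "unitize (a + b) = unitize a + unitize b" "unitize (a - b) = unitize a - unitize b"
  "unitize (a * b) = unitize a * unitize b" "unitize (r *\<^sub>R a) = r *\<^sub>R unitize a"
  "unitize (c *\<^sub>C a) = c *\<^sub>C unitize a" "unitize (star a) = star (unitize a)"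
  by (simp_all add: unitization_eq_iff)

lemma unitize_sum: "unitize (\<Sum>i\<in>I. f i) = (\<Sum>i\<in>I. unitize (f i))"
  by (induction I rule: infinite_finite_induct) (auto simp: unitize_hom)

text \<open>Left multiplication by \<open>a\<close> attains its norm at
  \<open>star a\<close>.\<close>

lemma norm_unitize [simp]: "norm (unitize a) = norm a"
proof (rule antisym)
  show "norm (unitize a) \<le> norm a" using norm_unitization_le[of "unitize a"] by simp
  show "norm a \<le> norm (unitize a)"
  proof (cases "a = 0")
    case False
    have "norm a * norm a = norm (unitization_op (unitize a) (star a))"
      using cstar_identity[of "star a"] by (simp add: unitization_op_def star_star power2_eq_square)
    also have "\<dots> \<le> norm (unitize a) * norm a"
      using norm_unitization_op[of "unitize a" "star a"]
      by (rule order_trans) (auto simp: norm_unitization_def intro!: mult_right_mono)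
    finally show ?thesis using False by simp
  qed simp
qed

lemma bounded_linear_unitize: "bounded_linear unitize"
  by (rule bounded_linear_intro[of _ 1]) (auto simp: unitize_hom)

lemma tendsto_unitize_iff: "((\<lambda>x. unitize (f x)) \<longlongrightarrow> unitize a) F \<longleftrightarrow> (f \<longlongrightarrow> a) F"
  using bounded_linear.tendsto[OF bounded_linear_alg, of "\<lambda>x. unitize (f x)" "unitize a" F]
    bounded_linear.tendsto[OF bounded_linear_unitize, of f a F] by auto

text \<open>If \<open>star y * y\<close> has scalar part 0, then so has \<open>y\<close>: a factor
  found in the unitization already comes from the algebra.\<close>

lemma positive_unitize_iff: "positive (unitize a) \<longleftrightarrow> positive a"
proof
  assume "positive (unitize a)"
  then obtain y where y: "unitize a = star y * y" by (auto simp: positive_def)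
  from arg_cong[OF y, of scal] have "scal y = 0" by simp
  with arg_cong[OF y, of alg] have "a = star (alg y) * alg y" by simp
  then show "positive a" by (auto simp: positive_def)
next
  assume "positive a"
  then show "positive (unitize a)" by (auto simp: positive_def unitize_hom)
qed

section \<open>The positive cone of an algebra without a unit\<close>

lemma positive_zero [simp]: "positive (0 :: 'a::cstar_algebra)"
  unfolding positive_def by (rule exI[of _ 0]) simp

lemma positive_star_mult [simp]: "positive (star x * x)"
  unfolding positive_def by blast

lemma positive_add: "positive x \<Longrightarrow> positive y \<Longrightarrow> positive (x + y)"
  using kv_positive_add[of "unitize x" "unitize y"]
  by (simp add: positive_unitize_iff flip: positive_iff_kv_positive unitize_hom(2))

lemma positive_sum: "(\<And>i. i \<in> I \<Longrightarrow> positive (f i)) \<Longrightarrow> positive (\<Sum>i\<in>I. f i)"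
  by (induction I rule: infinite_finite_induct) (auto intro: positive_add)

lemma positive_scaleR: "0 \<le> r \<Longrightarrow> positive x \<Longrightarrow> positive (r *\<^sub>R x)"
  unfolding positive_def
  by (clarsimp, rule_tac x="sqrt r *\<^sub>R y" in exI) (simp add: star_scaleR)

lemma positive_LIMSEQ: "X \<longlonglongrightarrow> x \<Longrightarrow> (\<And>k. positive (X k)) \<Longrightarrow> positive x"
  using kv_positive_LIMSEQ[of "\<lambda>k. unitize (X k)" "unitize x"]
  by (simp add: tendsto_unitize_iff positive_unitize_iff flip: positive_iff_kv_positive)

lemma norm_le_norm_add_positive: "positive x \<Longrightarrow> positive y \<Longrightarrow> norm x \<le> norm (x + y)"
  using kv_positive_norm_mono[of "unitize x" "unitize y"]
  by (simp add: positive_unitize_iff flip: positive_iff_kv_positive unitize_hom(2))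

section \<open>Operator exponentials and completely positive maps\<close>

text \<open>Bounded operators with composition as product, so that \<open>exp\<close> and
  \<open>exp_add_commuting\<close> apply to operators. The sort \<open>perfect_space\<close> in the
  instances below excludes the zero space, on which the identity does not have norm 1.\<close>

typedef (overloaded) 'b endo = "UNIV :: ('b::real_normed_vector \<Rightarrow>\<^sub>L 'b) set"
  morphisms app Endo by simp

lemma app_Endo [simp]: "app (Endo T) = T"
  by (simp add: Endo_inverse)

lemma endo_eq_iff: "S = T \<longleftrightarrow> app S = app T"
  by (simp add: app_inject)

instantiation endo :: ("{real_normed_vector, perfect_space}") real_normed_algebra_1
begin

definition "(0 :: 'a endo) = Endo 0"
definition "(1 :: 'a endo) = Endo id_blinfun"
definition "(S :: 'a endo) + T = Endo (app S + app T)"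
definition "(S :: 'a endo) - T = Endo (app S - app T)"
definition "- (S :: 'a endo) = Endo (- app S)"
definition "(S :: 'a endo) * T = Endo (app S o\<^sub>L app T)"
definition "r *\<^sub>R (S :: 'a endo) = Endo (r *\<^sub>R app S)"
definition "norm (S :: 'a endo) = norm (app S)"
definition "sgn (S :: 'a endo) = inverse (norm S) *\<^sub>R S"
definition "dist (S :: 'a endo) T = norm (S - T)"
definition "uniformity = (INF e\<in>{0<..}. principal {(x, y :: 'a endo). dist x y < e})"
definition "open (S :: 'a endo set) \<longleftrightarrow> (\<forall>x\<in>S. \<forall>\<^sub>F (x', y) in uniformity. x' = x \<longrightarrow> y \<in> S)"

lemma app_simps [simp]:
  "app (0 :: 'a endo) = 0" "app (1 :: 'a endo) = id_blinfun"
  "app (S + T) = app S + app T" "app (S - T) = app S - app T" "app (- S) = - app S"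
  "app (S * T) = app S o\<^sub>L app T" "app (r *\<^sub>R S) = r *\<^sub>R app S" for S T :: "'a endo"
  by (auto simp: zero_endo_def one_endo_def plus_endo_def minus_endo_def uminus_endo_def
    times_endo_def scaleR_endo_def)

instance
proof
  fix S T :: "'a endo"
  show "norm (1 :: 'a endo) = 1" by (simp add: norm_endo_def)
  show "norm (S * T) \<le> norm S * norm T" by (simp add: norm_endo_def norm_blinfun_compose)
  show "(0 :: 'a endo) \<noteq> 1"
  proof -
    have "norm (id_blinfun :: 'a \<Rightarrow>\<^sub>L 'a) \<noteq> 0" by simp
    then have "(id_blinfun :: 'a \<Rightarrow>\<^sub>L 'a) \<noteq> 0" unfolding norm_eq_zero .
    then show ?thesis by (metis app_simps(1,2))
  qed
qed (auto simp: norm_endo_def endo_eq_iff blinfun.bilinear_simps blinfun_eqI algebra_simps norm_triangle_ineq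
    dist_endo_def sgn_endo_def uniformity_endo_def open_endo_def intro!: blinfun_eqI)

end

lemma bounded_linear_app: "bounded_linear (app :: 'a::{real_normed_vector, perfect_space} endo \<Rightarrow> _)"
  by (rule bounded_linear_intro[of _ 1]) (auto simp: norm_endo_def)

instance endo :: ("{banach, perfect_space}") banach
proof
  fix X :: "nat \<Rightarrow> 'a endo"
  assume "Cauchy X"
  then have "Cauchy (\<lambda>k. app (X k))" by (rule bounded_linear.Cauchy[OF bounded_linear_app])
  then obtain T where "(\<lambda>k. app (X k)) \<longlonglongrightarrow> T" using Cauchy_convergent convergent_def by metis
  then have "(\<lambda>k. norm (X k - Endo T)) \<longlonglongrightarrow> 0"
    by (auto simp: norm_endo_def tendsto_norm_zero_iff LIM_zero_iff)
  then have "X \<longlonglongrightarrow> Endo T"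
    by (simp add: tendsto_norm_zero_iff LIM_zero_iff)
  then show "convergent X" by (auto simp: convergent_def)
qed

abbreviation endo_apply :: "'b::real_normed_vector endo \<Rightarrow> 'b \<Rightarrow> 'b"  (infixl "\<bullet>\<^sub>E" 75)
  where "T \<bullet>\<^sub>E x \<equiv> blinfun_apply (app T) x"

lemma bounded_linear_endo_apply:
  "bounded_linear (\<lambda>T. T \<bullet>\<^sub>E (x :: 'a::{real_normed_vector, perfect_space}))"
  by (rule bounded_linear_compose[OF blinfun.bounded_linear_left bounded_linear_app])

definition endo_of :: "('b::real_normed_vector \<Rightarrow> 'b) \<Rightarrow> 'b endo"
  where "endo_of f = Endo (Blinfun f)"

lemma endo_of_apply: "bounded_linear f \<Longrightarrow> endo_of f \<bullet>\<^sub>E x = f x"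
  by (simp add: endo_of_def bounded_linear_Blinfun_apply)

lemma endo_eqI: "(\<And>x. S \<bullet>\<^sub>E x = T \<bullet>\<^sub>E x) \<Longrightarrow> S = T"
  by (simp add: endo_eq_iff blinfun_eqI)

lemma endo_power_apply:
  "(T ^ k) \<bullet>\<^sub>E (x :: 'a::{real_normed_vector, perfect_space}) = (blinfun_apply (app T) ^^ k) x"
  by (induction k) auto

text \<open>Only powers of the single element \<open>x\<close> have to be respected. This covers
  antimultiplicative maps as well, namely \<open>star\<close> and the passage from \<open>a\<close>
  to right multiplication by \<open>a\<close>.\<close>

lemma exp_bounded_linear:
  fixes f :: "'a::{real_normed_algebra_1, banach} \<Rightarrow> 'b::{real_normed_algebra_1, banach}"
  assumes "bounded_linear f" "\<And>k. f (x ^ k) = f x ^ k"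
  shows "f (exp x) = exp (f x)"
proof -
  have "f (exp x) = suminf (\<lambda>k. f (x ^ k /\<^sub>R fact k))"
    unfolding exp_def by (rule bounded_linear.suminf[OF assms(1)]) (rule summable_exp_generic)
  also have "\<dots> = exp (f x)"
    by (simp add: exp_def linear_scale[OF bounded_linear.linear[OF assms(1)]] assms(2))
  finally show ?thesis .
qed

lemma exp_endo_apply:
  fixes T :: "'a::{banach, perfect_space} endo"
  shows "(\<lambda>k. (t ^ k / fact k) *\<^sub>R (blinfun_apply (app T) ^^ k) x) sums (exp (t *\<^sub>R T) \<bullet>\<^sub>E x)"
  using bounded_linear.sums[OF bounded_linear_endo_apply exp_converges[of "t *\<^sub>R T"], of x]
  by (simp add: scaleR_power endo_power_apply blinfun.scaleR_left divide_inverse mult.commute)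

lemma star_exp:
  fixes x :: "'a::{cstar_algebra, real_normed_algebra_1}"
  shows "star (exp x) = exp (star x)"
proof (rule exp_bounded_linear[OF bounded_linear_star])
  show "star (x ^ k) = star x ^ k" for k
    by (induction k) (auto simp: star_mult power_commutes)
qed

lemma exp_left_mult:
  fixes a :: "'a::{real_normed_algebra_1, banach}"
  shows "exp (endo_of (\<lambda>x. a * x)) \<bullet>\<^sub>E x = exp a * x"
proof -
  have ap: "endo_of (\<lambda>x. a * x) \<bullet>\<^sub>E x = a * x" for a x :: 'a
    by (rule endo_of_apply[OF bounded_linear_mult_right])
  have bl: "bounded_linear (\<lambda>a. endo_of (\<lambda>x. a * x) :: 'a endo)"
  proof (rule bounded_linear_intro[of _ 1])
    fix a b :: 'a and r :: real
    show "endo_of (\<lambda>x. (a + b) * x) = endo_of (\<lambda>x. a * x) + endo_of (\<lambda>x. b * x)"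
      by (rule endo_eqI) (simp only: ap app_simps blinfun.add_left, simp only: distrib_right)
    show "endo_of (\<lambda>x. (r *\<^sub>R a) * x) = r *\<^sub>R endo_of (\<lambda>x. a * x)"
      by (rule endo_eqI) (simp only: ap app_simps blinfun.scaleR_left, simp)
    show "norm (endo_of (\<lambda>x. a * x)) \<le> norm a * 1"
      unfolding norm_endo_def by (rule norm_blinfun_bound) (auto simp: ap norm_mult_ineq)
  qed
  have "endo_of (\<lambda>x. a * x) ^ k \<bullet>\<^sub>E x = a ^ k * x" for k x
    by (induction k) (simp_all add: ap mult.assoc)
  then have "endo_of (\<lambda>x. a ^ k * x) = endo_of (\<lambda>x. a * x) ^ k" for k
    by (intro endo_eqI) (simp only: ap)
  from exp_bounded_linear[OF bl this] ap[of "exp a" x] show ?thesis by simp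
qed

lemma exp_right_mult:
  fixes a :: "'a::{real_normed_algebra_1, banach}"
  shows "exp (endo_of (\<lambda>x. x * a)) \<bullet>\<^sub>E x = x * exp a"
proof -
  have ap: "endo_of (\<lambda>x. x * a) \<bullet>\<^sub>E x = x * a" for a x :: 'a
    by (rule endo_of_apply[OF bounded_linear_mult_left])
  have bl: "bounded_linear (\<lambda>a. endo_of (\<lambda>x. x * a) :: 'a endo)"
  proof (rule bounded_linear_intro[of _ 1])
    fix a b :: 'a and r :: real
    show "endo_of (\<lambda>x. x * (a + b)) = endo_of (\<lambda>x. x * a) + endo_of (\<lambda>x. x * b)"
      by (rule endo_eqI) (simp only: ap app_simps blinfun.add_left, simp only: distrib_left)
    show "endo_of (\<lambda>x. x * (r *\<^sub>R a)) = r *\<^sub>R endo_of (\<lambda>x. x * a)"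
      by (rule endo_eqI) (simp only: ap app_simps blinfun.scaleR_left, simp)
    show "norm (endo_of (\<lambda>x. x * a)) \<le> norm a * 1"
      unfolding norm_endo_def
      by (rule norm_blinfun_bound) (use norm_mult_ineq in \<open>auto simp: ap mult.commute[of "norm a"]\<close>)
  qed
  have "endo_of (\<lambda>x. x * a) ^ k \<bullet>\<^sub>E x = x * a ^ k" for k x
    by (induction k) (simp_all add: ap mult.assoc power_commutes)
  then have "endo_of (\<lambda>x. x * a ^ k) = endo_of (\<lambda>x. x * a) ^ k" for k
    by (intro endo_eqI) (simp only: ap)
  from exp_bounded_linear[OF bl this] ap[of "exp a" x] show ?thesis by simp
qed

section \<open>Closure properties of completely positive maps\<close>

lemma completely_positiveI:
  assumes "complex_linear f"
    "\<And>m (a :: nat \<Rightarrow> 'a) b. positive (\<Sum>i<m. \<Sum>j<m. star (b i) * f (star (a i) * a j) * b j)"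
  shows "completely_positive (f :: 'a::cstar_algebra \<Rightarrow> 'a)"
  using assms by (simp add: completely_positive_def)

lemma completely_positiveD:
  assumes "completely_positive f"
  shows "f (x + y) = f x + f y" "f (c *\<^sub>C x) = c *\<^sub>C f x"
    "positive (\<Sum>i<(m::nat). \<Sum>j<m. star (b i) * f (star (a i) * a j) * b j)"
  using assms by (auto simp: completely_positive_def complex_linear_def)

lemma completely_positive_id: "completely_positive (\<lambda>x. x :: 'a::cstar_algebra)"
proof (rule completely_positiveI)
  fix m and a b :: "nat \<Rightarrow> 'a"
  have "(\<Sum>i<m. \<Sum>j<m. star (b i) * (star (a i) * a j) * b j) =
      star (\<Sum>j<m. a j * b j) * (\<Sum>j<m. a j * b j)"
    by (simp add: star_sum sum_product star_mult mult.assoc)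
  then show "positive (\<Sum>i<m. \<Sum>j<m. star (b i) * (star (a i) * a j) * b j)" by simp
qed (simp add: complex_linear_def)

text \<open>The element \<open>v\<close> is absorbed into the family:
  \<open>star v * (star (a i) * a j) * v\<close> is
  \<open>star (a i * v) * (a j * v)\<close>.\<close>

lemma completely_positive_conj:
  assumes "completely_positive f"
  shows "completely_positive (\<lambda>x. f (star v * x * v))"
proof (rule completely_positiveI)
  fix m and a b :: "nat \<Rightarrow> 'a"
  have "positive (\<Sum>i<m. \<Sum>j<m. star (b i) * f (star (a i * v) * (a j * v)) * b j)"
    using assms by (rule completely_positiveD)
  then show "positive (\<Sum>i<m. \<Sum>j<m. star (b i) * f (star v * (star (a i) * a j) * v) * b j)"
    by (simp add: star_mult mult.assoc)
qed (use assms in \<open>simp add: completely_positive_def complex_linear_def algebra_simps cstar_simps\<close>)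

lemma completely_positive_add:
  assumes "completely_positive f" "completely_positive g"
  shows "completely_positive (\<lambda>x. f x + g x)"
proof (rule completely_positiveI)
  fix m and a b :: "nat \<Rightarrow> 'a"
  show "positive (\<Sum>i<m. \<Sum>j<m. star (b i) * (f (star (a i) * a j) + g (star (a i) * a j)) * b j)"
    unfolding distrib_left distrib_right sum.distrib
    by (intro positive_add completely_positiveD assms)
qed (use assms in \<open>simp add: completely_positive_def complex_linear_def scaleC_add_right\<close>)

lemma completely_positive_zero: "completely_positive (\<lambda>x. 0 :: 'a::cstar_algebra)"
  by (simp add: completely_positive_def complex_linear_def)

lemma completely_positive_sum:
  "(\<And>i. i \<in> I \<Longrightarrow> completely_positive (f i)) \<Longrightarrow> completely_positive (\<lambda>x. \<Sum>i\<in>I. f i x)"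
  by (induction I rule: infinite_finite_induct)
    (auto intro: completely_positive_add completely_positive_zero)

lemma completely_positive_scaleR:
  assumes "completely_positive f" "0 \<le> r"
  shows "completely_positive (\<lambda>x. r *\<^sub>R f x)"
proof (rule completely_positiveI)
  fix m and a b :: "nat \<Rightarrow> 'a"
  have "positive (r *\<^sub>R (\<Sum>i<m. \<Sum>j<m. star (b i) * f (star (a i) * a j) * b j))"
    by (intro positive_scaleR completely_positiveD assms)
  then show "positive (\<Sum>i<m. \<Sum>j<m. star (b i) * (r *\<^sub>R f (star (a i) * a j)) * b j)"
    by (simp add: scaleR_sum_right)
qed (use assms in \<open>simp add: completely_positive_def complex_linear_def scaleR_add_right scaleC_scaleR\<close>)

text \<open>Each instance of the condition involves finitely many values of the map, so pointwise
  limits suffice because the positive cone is closed.\<close>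

lemma completely_positive_LIMSEQ:
  fixes f :: "'a::cstar_algebra \<Rightarrow> 'a"
  assumes lim: "\<And>x. (\<lambda>k. F k x) \<longlonglongrightarrow> f x" and F: "\<And>k. completely_positive (F k)"
  shows "completely_positive f"
proof (rule completely_positiveI)
  fix m and a b :: "nat \<Rightarrow> 'a"
  have "(\<lambda>k. \<Sum>i<m. \<Sum>j<m. star (b i) * F k (star (a i) * a j) * b j)
      \<longlonglongrightarrow> (\<Sum>i<m. \<Sum>j<m. star (b i) * f (star (a i) * a j) * b j)"
    by (intro tendsto_intros lim)
  then show "positive (\<Sum>i<m. \<Sum>j<m. star (b i) * f (star (a i) * a j) * b j)"
    by (rule positive_LIMSEQ) (use F in \<open>auto simp: completely_positive_def\<close>)
next
  have lin: "F k (x + y) = F k x + F k y" "F k (c *\<^sub>C x) = c *\<^sub>C F k x" for k c x y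
    using F by (auto simp: completely_positive_def complex_linear_def)
  have "f (x + y) = f x + f y" for x y
    using LIMSEQ_unique[OF lim[of "x + y"]] tendsto_add[OF lim[of x] lim[of y]] by (simp add: lin)
  moreover have "f (c *\<^sub>C x) = c *\<^sub>C f x" for c x
    using LIMSEQ_unique[OF lim[of "c *\<^sub>C x"]] bounded_linear.tendsto[OF bounded_linear_scaleC lim[of x]]
    by (simp add: lin)
  ultimately show "complex_linear f" by (simp add: complex_linear_def)
qed

text \<open>The two-element families \<open>(x, 1)\<close> and \<open>(1, c)\<close> give a
  positive, hence self-adjoint, sum whose diagonal terms are self-adjoint. So
  \<open>c f(star x) + cnj c f(x)\<close> is self-adjoint for every \<open>c\<close>, and the cases
  \<open>c = 1\<close> and \<open>c = \<i>\<close> together separate the two terms.\<close>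

lemma completely_positive_star:
  fixes f :: "'a::{cstar_algebra, real_normed_algebra_1} \<Rightarrow> 'a"
  assumes f: "completely_positive f"
  shows "f (star x) = star (f x)"
proof -
  let ?a = "\<lambda>i::nat. if i = 0 then x else 1"
  have pos: "positive (f (star y * y))" for y
    using completely_positiveD(3)[OF f, of "\<lambda>_. 1" "\<lambda>_. y" 1] by simp
  have sa: "star y = y" if "positive y" for y :: 'a
    using that by (auto simp: positive_def star_mult star_star)
  have herm: "star (c *\<^sub>C f (star x) + cnj c *\<^sub>C f x) = c *\<^sub>C f (star x) + cnj c *\<^sub>C f x" for c
  proof -
    let ?b = "\<lambda>i::nat. if i = 0 then 1 else c *\<^sub>C (1 :: 'a)"
    have "star (\<Sum>i<2. \<Sum>j<2. star (?b i) * f (star (?a i) * ?a j) * ?b j) =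
        (\<Sum>i<2. \<Sum>j<2. star (?b i) * f (star (?a i) * ?a j) * ?b j)"
      by (rule sa) (rule completely_positiveD(3)[OF f])
    then show ?thesis
      using sa[OF pos[of x]] sa[OF pos[of 1]]
      by (simp add: numeral_2_eq_2 lessThan_Suc cstar_simps mult.commute[of "cnj c"] algebra_simps)
  qed
  have *: "star (f (star x)) + star (f x) = f (star x) + f x"
    using herm[of 1] by (simp add: star_add)
  have "(- \<i>) *\<^sub>C star (f (star x)) + \<i> *\<^sub>C star (f x) = \<i> *\<^sub>C f (star x) + (- \<i>) *\<^sub>C f x"
    using herm[of \<i>] by (simp add: star_add star_scaleC)
  from arg_cong[OF this, of "\<lambda>y. (- \<i>) *\<^sub>C y"]
  have "star (f x) - star (f (star x)) = f (star x) - f x"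
    by (simp add: scaleC_add_right scaleC_scaleC scaleC_diff_right scaleC_minus_one scaleC_minus_left scaleC_minus_right)
  with * have "(star (f (star x)) + star (f x)) + (star (f x) - star (f (star x))) =
      (f (star x) + f x) + (f (star x) - f x)"
    by (simp only:)
  then have "2 *\<^sub>R star (f x) = 2 *\<^sub>R f (star x)"
    by (simp add: scaleR_2)
  then show ?thesis by simp
qed

text \<open>The Kadison--Schwarz inequality gives \<open>\<Phi>(x)\<^sup>* \<Phi>(x) \<le> \<Phi>(x\<^sup>* x) \<le> \<parallel>x\<parallel>\<^sup>2\<close>.\<close>

lemma completely_positive_contraction:
  fixes f :: "'a::{cstar_algebra, real_normed_algebra_1} \<Rightarrow> 'a"
  assumes f: "completely_positive f" and one: "f 1 = 1"
  shows "norm (f x) \<le> norm x"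
proof -
  note lin = completely_positiveD(1,2)[OF f]
  have diff: "f (y - z) = f y - f z" for y z using lin(1)[of "y - z" z] by simp
  have real: "f (of_real r) = of_real r" for r
    using lin(2)[of "of_real r" 1] unfolding scaleC_of_real by (simp add: one of_real_def)
  let ?r = "(norm x)\<^sup>2"
  have "positive (of_real ?r - star x * x)"
    unfolding positive_iff_kv_positive
    by (intro kv_positive_norm_minus kv_positive_star_mult) (simp add: cstar_identity)
  then obtain z where z: "of_real ?r - star x * x = star z * z" by (auto simp: positive_def)
  have "positive (f (star z * z))"
    using completely_positiveD(3)[OF f, of "\<lambda>_. 1" "\<lambda>_. z" 1] by simp
  then have p1: "positive (of_real ?r - f (star x * x))"
    unfolding z[symmetric] diff real .
  \<comment> \<open>The families \<open>(x, 1)\<close> and \<open>(1, - f x)\<close>: since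
    \<open>f 1 = 1\<close>, the three terms other than \<open>f (star x * x)\<close> add up to
    \<open>- star (f x) * f x\<close>.\<close>
  have p2: "positive (f (star x * x) - star (f x) * f x)"
    using completely_positiveD(3)[OF f, of "\<lambda>i. if i = 0 then 1 else - f x" "\<lambda>i. if i = 0 then x else 1" 2]
    by (simp add: numeral_2_eq_2 lessThan_Suc one star_minus completely_positive_star[OF f])
  have "norm (star (f x) * f x) \<le> norm (star (f x) * f x +
      (f (star x * x) - star (f x) * f x + (of_real ?r - f (star x * x))))"
    by (intro norm_le_norm_add_positive positive_add p1 p2 positive_star_mult)
  then have "(norm (f x))\<^sup>2 \<le> (norm x)\<^sup>2"
    by (simp add: cstar_identity del: of_real_power)
  then show ?thesis by (rule power2_le_imp_le) simp
qed

section \<open>The semigroup\<close>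

lemma exp_semigroup_fixed:
  assumes "\<Delta> e = 0" "\<Delta> 0 = 0"
  shows "exp_semigroup \<Delta> t e = e"
proof -
  have "(\<Delta> ^^ k) e = 0" if "k > 0" for k
    using that by (induction k rule: nat_induct_non_zero) (simp_all add: assms)
  then have "(\<lambda>k. ((- t) ^ k / fact k) *\<^sub>R (\<Delta> ^^ k) e) sums (\<Sum>k\<in>{0}. ((- t) ^ k / fact k) *\<^sub>R (\<Delta> ^^ k) e)"
    by (intro sums_finite) auto
  then show ?thesis by (simp add: exp_semigroup_def sums_iff)
qed

lemma exp_semigroup_zero_time: "exp_semigroup \<Delta> 0 x = x"
proof -
  have "(\<lambda>k. ((- 0) ^ k / fact k) *\<^sub>R (\<Delta> ^^ k) x) sums (\<Sum>k\<in>{0}. ((- 0) ^ k / fact k) *\<^sub>R (\<Delta> ^^ k) x)"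
    by (rule sums_finite) auto
  then show ?thesis by (simp add: exp_semigroup_def sums_iff)
qed

text \<open>Normality of each \<open>V i\<close> is the case \<open>i = j\<close> of
  \<open>comm_star\<close>. The algebra is unital here because the locale is used for the
  unitization.\<close>

locale commuting_normals =
  fixes I :: "'i set" and V :: "'i \<Rightarrow> 'b::{cstar_algebra, real_normed_algebra_1}"
  assumes comm: "\<And>i j. i \<in> I \<Longrightarrow> j \<in> I \<Longrightarrow> V i * V j = V j * V i"
    and comm_star: "\<And>i j. i \<in> I \<Longrightarrow> j \<in> I \<Longrightarrow> V i * star (V j) = star (V j) * V i"
begin

definition gen :: "'b \<Rightarrow> 'b"
  where "gen x = (\<Sum>i\<in>I. commutator (star (V i)) (commutator (V i) x))"

definition dens :: 'b
  where "dens = (\<Sum>i\<in>I. star (V i) * V i)"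

definition jump :: "'b \<Rightarrow> 'b"
  where "jump x = (\<Sum>i\<in>I. star (V i) * x * V i + V i * x * star (V i))"

lemma bounded_linear_jump: "bounded_linear jump"
proof -
  have "bounded_linear (\<lambda>x. a * x * b)" for a b :: 'b
    by (rule bounded_linear_compose[OF bounded_linear_mult_left bounded_linear_mult_right])
  then show ?thesis
    unfolding jump_def[abs_def] by (intro bounded_linear_sum bounded_linear_add)
qed

lemma gen_eq: "gen x = dens * x + x * dens - jump x"
proof -
  have "commutator (star (V i)) (commutator (V i) x) =
      star (V i) * V i * x + x * (star (V i) * V i) - (star (V i) * x * V i + V i * x * star (V i))"
    if "i \<in> I" for i
    using comm_star[OF that that] by (simp add: commutator_def algebra_simps)
  then show ?thesis
    by (simp add: gen_def dens_def jump_def sum_distrib_left sum_distrib_right sum.distrib sum_subtractf)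
qed

lemma star_dens: "star dens = dens"
  by (simp add: dens_def star_sum star_mult star_star)

lemma dens_commute:
  assumes "i \<in> I"
  shows "dens * V i = V i * dens" "dens * star (V i) = star (V i) * dens"
proof -
  have *: "star (V j) * V j * V i = V i * (star (V j) * V j)" if "j \<in> I" for j
  proof -
    have "star (V j) * V j * V i = star (V j) * V i * V j"
      by (simp only: mult.assoc comm[OF that assms])
    also have "\<dots> = V i * star (V j) * V j"
      by (simp only: comm_star[OF assms that])
    finally show ?thesis by (simp only: mult.assoc)
  qed
  then show "dens * V i = V i * dens"
    by (simp add: dens_def sum_distrib_left sum_distrib_right)
  from arg_cong[OF this, of star] show "dens * star (V i) = star (V i) * dens"
    by (simp add: star_mult star_dens)
qed

definition left :: "'b endo" where "left = endo_of (\<lambda>x. dens * x)"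
definition right :: "'b endo" where "right = endo_of (\<lambda>x. x * dens)"
definition jump_endo :: "'b endo" where "jump_endo = endo_of jump"
definition gen_endo :: "'b endo" where "gen_endo = left + right - jump_endo"

lemma endo_simps [simp]:
  "left \<bullet>\<^sub>E x = dens * x" "right \<bullet>\<^sub>E x = x * dens" "jump_endo \<bullet>\<^sub>E x = jump x"
  by (simp_all add: left_def right_def jump_endo_def endo_of_apply bounded_linear_mult_left
    bounded_linear_mult_right bounded_linear_jump)

lemma gen_endo_apply: "gen_endo \<bullet>\<^sub>E x = gen x"
  by (simp add: gen_endo_def blinfun.bilinear_simps gen_eq)

lemma endo_commute: "left * right = right * left"
  "jump_endo * left = left * jump_endo" "jump_endo * right = right * jump_endo"
proof -
  show "left * right = right * left" by (rule endo_eqI) (simp add: mult.assoc)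
  have l: "star (V i) * (dens * x) * V i + V i * (dens * x) * star (V i) =
      dens * (star (V i) * x * V i + V i * x * star (V i))" if "i \<in> I" for i x
  proof -
    have "V i * (dens * y) = dens * (V i * y)" "star (V i) * (dens * y) = dens * (star (V i) * y)" for y
      using dens_commute[OF that] by (simp_all only: flip: mult.assoc)
    then show ?thesis by (simp only: mult.assoc distrib_left)
  qed
  have r: "star (V i) * (x * dens) * V i + V i * (x * dens) * star (V i) =
      (star (V i) * x * V i + V i * x * star (V i)) * dens" if "i \<in> I" for i x
    by (simp only: mult.assoc distrib_right dens_commute[OF that])
  show "jump_endo * left = left * jump_endo"
    by (rule endo_eqI) (simp add: jump_def l sum_distrib_left)
  show "jump_endo * right = right * jump_endo"
    by (rule endo_eqI) (simp add: jump_def r sum_distrib_right)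
qed

lemma exp_semigroup_gen: "exp_semigroup gen t x = exp ((- t) *\<^sub>R gen_endo) \<bullet>\<^sub>E x"
proof -
  have "blinfun_apply (app gen_endo) = gen" by (rule ext) (rule gen_endo_apply)
  with exp_endo_apply[of "- t" gen_endo x] show ?thesis
    by (simp add: exp_semigroup_def sums_iff)
qed

text \<open>Placing \<open>jump\<close> inside \<open>f\<close> reduces the claim to conjugations,
  which the dilation form of complete positivity absorbs directly; iterates of \<open>jump\<close>
  are then built from the inside.\<close>

lemma completely_positive_comp_jump:
  assumes f: "completely_positive f"
  shows "completely_positive (\<lambda>x. f (jump x))"
proof -
  have f_sum: "f (\<Sum>i\<in>J. g i) = (\<Sum>i\<in>J. f (g i))" for g :: "'i \<Rightarrow> 'b" and J
  proof -
    have "f 0 = 0" using completely_positiveD(1)[OF f, of 0 0] by simp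
    then show ?thesis
      by (induction J rule: infinite_finite_induct) (auto simp: completely_positiveD(1)[OF f])
  qed
  have "completely_positive (\<lambda>x. \<Sum>i\<in>I. f (star (V i) * x * V i) + f (star (star (V i)) * x * star (V i)))"
    by (intro completely_positive_sum completely_positive_add completely_positive_conj f)
  then show ?thesis
    by (simp add: jump_def f_sum completely_positiveD(1)[OF f] star_star)
qed

lemma completely_positive_exp_jump:
  assumes "0 \<le> t"
  shows "completely_positive (\<lambda>x. exp (t *\<^sub>R jump_endo) \<bullet>\<^sub>E x)"
proof (rule completely_positive_LIMSEQ)
  have app: "blinfun_apply (app jump_endo) = jump" by (rule ext) simp
  show "(\<lambda>m. \<Sum>k<m. (t ^ k / fact k) *\<^sub>R (jump ^^ k) x) \<longlonglongrightarrow> exp (t *\<^sub>R jump_endo) \<bullet>\<^sub>E x" for x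
    using exp_endo_apply[of t jump_endo x] by (simp add: sums_def app)
  have "completely_positive (jump ^^ k)" for k
  proof (induction k)
    case 0
    show ?case using completely_positive_id by (simp add: id_def)
  next
    case (Suc k)
    from completely_positive_comp_jump[OF this] show ?case
      by (simp add: funpow_Suc_right comp_def del: funpow.simps)
  qed
  then show "completely_positive (\<lambda>x. \<Sum>k<m. (t ^ k / fact k) *\<^sub>R (jump ^^ k) x)" for m
    using assms by (intro completely_positive_sum completely_positive_scaleR) auto
qed

text \<open>The left factor is written with \<open>star\<close>, which changes nothing because
  \<open>dens\<close> is self-adjoint, so that the inner map has the form required by
  \<open>completely_positive_conj\<close>.\<close>

lemma exp_semigroup_gen_factor:
  "exp_semigroup gen t x =
    exp (t *\<^sub>R jump_endo) \<bullet>\<^sub>E (star (exp ((- t) *\<^sub>R dens)) * x * exp ((- t) *\<^sub>R dens))"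
proof -
  let ?r = "- t"
  have lr: "endo_of (\<lambda>x. (?r *\<^sub>R dens) * x) = ?r *\<^sub>R left" "endo_of (\<lambda>x. x * (?r *\<^sub>R dens)) = ?r *\<^sub>R right"
    by (rule endo_eqI, simp only: endo_of_apply[OF bounded_linear_mult_left] endo_of_apply[OF bounded_linear_mult_right]
      app_simps blinfun.scaleR_left endo_simps, simp)+
  have "(- t) *\<^sub>R gen_endo = t *\<^sub>R jump_endo + (?r *\<^sub>R left + ?r *\<^sub>R right)"
    by (simp add: gen_endo_def algebra_simps)
  then have "exp ((- t) *\<^sub>R gen_endo) = exp (t *\<^sub>R jump_endo + (?r *\<^sub>R left + ?r *\<^sub>R right))"
    by (rule arg_cong)
  also have "\<dots> = exp (t *\<^sub>R jump_endo) * exp (?r *\<^sub>R left + ?r *\<^sub>R right)"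
    by (rule exp_add_commuting) (simp add: left_diff_distrib right_diff_distrib scaleR_diff_right endo_commute)
  also have "exp (?r *\<^sub>R left + ?r *\<^sub>R right) = exp (?r *\<^sub>R left) * exp (?r *\<^sub>R right)"
    by (rule exp_add_commuting) (simp add: endo_commute)
  finally have *: "exp ((- t) *\<^sub>R gen_endo) =
      exp (t *\<^sub>R jump_endo) * (exp (?r *\<^sub>R left) * exp (?r *\<^sub>R right))" .
  have "star (exp (?r *\<^sub>R dens)) = exp (?r *\<^sub>R dens)"
    by (simp only: star_exp star_scaleR star_dens)
  then show ?thesis
    unfolding exp_semigroup_gen * lr[symmetric]
    by (simp only: app_simps blinfun_apply_blinfun_compose exp_left_mult exp_right_mult mult.assoc)
qed

lemma completely_positive_exp_semigroup:
  assumes "0 \<le> t"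
  shows "completely_positive (exp_semigroup gen t)"
  unfolding exp_semigroup_gen_factor[abs_def]
  by (rule completely_positive_conj[OF completely_positive_exp_jump[OF assms]])

text \<open>Commutators with 1 vanish, so \<open>gen 1 = 0\<close> and the semigroup fixes
  1.\<close>

lemma norm_exp_semigroup_le:
  assumes "0 \<le> t"
  shows "norm (exp_semigroup gen t x) \<le> norm x"
  using completely_positive_exp_semigroup[OF assms]
  by (rule completely_positive_contraction)
    (auto intro!: exp_semigroup_fixed simp: gen_def commutator_def)

lemma exp_semigroup_add: "exp_semigroup gen (s + t) x = exp_semigroup gen s (exp_semigroup gen t x)"
proof -
  have "exp ((- (s + t)) *\<^sub>R gen_endo) = exp ((- s) *\<^sub>R gen_endo + (- t) *\<^sub>R gen_endo)"
    by (simp add: algebra_simps)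
  also have "\<dots> = exp ((- s) *\<^sub>R gen_endo) * exp ((- t) *\<^sub>R gen_endo)"
    by (rule exp_add_commuting) simp
  finally show ?thesis by (simp add: exp_semigroup_gen)
qed

lemma exp_semigroup_has_derivative:
  "((\<lambda>t. exp_semigroup gen t x) has_vector_derivative - gen x) (at 0 within {0<..})"
proof -
  have "((\<lambda>t. exp (t *\<^sub>R (- gen_endo))) has_vector_derivative exp (0 *\<^sub>R (- gen_endo)) * (- gen_endo)) (at 0 within {0<..})"
    by (rule exp_scaleR_has_vector_derivative_right)
  from bounded_linear.has_vector_derivative[OF bounded_linear_endo_apply this, of x]
  show ?thesis by (simp add: exp_semigroup_gen blinfun.bilinear_simps gen_endo_apply)
qed

lemma exp_semigroup_tendsto: "((\<lambda>t. exp_semigroup gen t x) \<longlongrightarrow> x) (at_right 0)"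
  using has_vector_derivative_continuous[OF exp_semigroup_has_derivative, of x]
  by (simp add: continuous_within exp_semigroup_zero_time)

lemma is_generator_exp_semigroup: "is_generator (exp_semigroup gen) gen"
  unfolding is_generator_def
proof
  fix x
  have "((\<lambda>t. (1 / norm (t - 0)) *\<^sub>R (exp_semigroup gen t x - (exp_semigroup gen 0 x + (t - 0) *\<^sub>R (- gen x)))) \<longlongrightarrow> 0)
      (at 0 within {0<..})"
    using exp_semigroup_has_derivative[of x]
    unfolding has_vector_derivative_def has_derivative_within by blast
  \<comment> \<open>To the right of 0 the absolute value of \<open>t\<close> is \<open>t\<close>, so
    the remainder of the derivative is the deviation of the generator quotient with opposite
    sign.\<close>
  moreover have "\<forall>\<^sub>F t in at_right 0.
      (1 / norm (t - 0)) *\<^sub>R (exp_semigroup gen t x - (exp_semigroup gen 0 x + (t - 0) *\<^sub>R (- gen x))) =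
      - ((1 / t) *\<^sub>R (x - exp_semigroup gen t x) - gen x)"
    using eventually_at_right_less[of 0]
    by eventually_elim (simp add: exp_semigroup_zero_time algebra_simps)
  ultimately have "((\<lambda>t. - ((1 / t) *\<^sub>R (x - exp_semigroup gen t x) - gen x)) \<longlongrightarrow> 0) (at_right 0)"
    by (rule Lim_transform_eventually)
  from tendsto_minus[OF this]
  have "((\<lambda>t. (1 / t) *\<^sub>R (x - exp_semigroup gen t x) - gen x) \<longlongrightarrow> 0) (at_right 0)"
    by simp
  then show "((\<lambda>t. (1 / t) *\<^sub>R (x - exp_semigroup gen t x)) \<longlongrightarrow> gen x) (at_right 0)"
    by (simp add: LIM_zero_iff)
qed

end

text \<open>Everything restricts to the algebra because \<open>unitize\<close> is isometric and detects positivity.\<close>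

context
  fixes I :: "'i set" and V :: "'i \<Rightarrow> 'a::cstar_algebra" and \<Delta> :: "'a \<Rightarrow> 'a"
  assumes comm: "\<And>i j. i \<in> I \<Longrightarrow> j \<in> I \<Longrightarrow> V i * V j = V j * V i"
    and comm_star: "\<And>i j. i \<in> I \<Longrightarrow> j \<in> I \<Longrightarrow> V i * star (V j) = star (V j) * V i"
    and \<Delta>: "\<Delta> = (\<lambda>x. \<Sum>i\<in>I. commutator (star (V i)) (commutator (V i) x))"
begin

interpretation U: commuting_normals I "\<lambda>i. unitize (V i)"
  by unfold_locales (simp_all add: comm comm_star flip: unitize_hom(4,7))

lemma unitize_generator: "unitize (\<Delta> x) = U.gen (unitize x)"
  by (simp add: \<Delta> U.gen_def commutator_def unitize_sum unitize_hom)

lemma unitize_exp_semigroup: "unitize (exp_semigroup \<Delta> t x) = exp_semigroup U.gen t (unitize x)"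
proof -
  let ?f = "\<lambda>k. ((- t) ^ k / fact k) *\<^sub>R (\<Delta> ^^ k) x"
  have gen: "blinfun_apply (app U.gen_endo) = U.gen"
    by (rule ext) (rule U.gen_endo_apply)
  have pow: "unitize ((\<Delta> ^^ k) x) = (U.gen ^^ k) (unitize x)" for k
    by (induction k) (simp_all add: unitize_generator)
  have *: "(\<lambda>k. unitize (?f k)) sums exp_semigroup U.gen t (unitize x)"
    using exp_endo_apply[of "- t" U.gen_endo "unitize x"]
    unfolding U.exp_semigroup_gen unitize_hom(5) pow gen .
  \<comment> \<open>Since \<open>exp_semigroup\<close> is defined by \<open>suminf\<close>,
    convergence in the algebra itself must be established; it is obtained by projecting the
    convergent series in the unitization.\<close>
  from bounded_linear.sums[OF bounded_linear_alg this]
  have "?f sums alg (exp_semigroup U.gen t (unitize x))" by simp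
  then have "?f sums exp_semigroup \<Delta> t x"
    unfolding exp_semigroup_def by (simp add: sums_iff)
  from bounded_linear.sums[OF bounded_linear_unitize this]
  show ?thesis using * by (rule sums_unique2)
qed

lemma cp_markov_exp_semigroup: "cp_markov_semigroup (exp_semigroup \<Delta>)"
  unfolding cp_markov_semigroup_def
proof (intro conjI allI impI)
  fix x show "exp_semigroup \<Delta> 0 x = x" by (rule exp_semigroup_zero_time)
next
  fix s t :: real and x
  have "unitize (exp_semigroup \<Delta> (s + t) x) = unitize (exp_semigroup \<Delta> s (exp_semigroup \<Delta> t x))"
    by (simp only: unitize_exp_semigroup U.exp_semigroup_add)
  then show "exp_semigroup \<Delta> (s + t) x = exp_semigroup \<Delta> s (exp_semigroup \<Delta> t x)"
    by (simp only: unitize_eq_iff)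
next
  fix x
  show "((\<lambda>t. exp_semigroup \<Delta> t x) \<longlongrightarrow> x) (at_right 0)"
    using U.exp_semigroup_tendsto[of "unitize x"]
    by (simp only: tendsto_unitize_iff flip: unitize_exp_semigroup)
next
  fix t :: real assume "0 \<le> t"
  note cp = completely_positiveD[OF U.completely_positive_exp_semigroup[OF this]]
  show "completely_positive (exp_semigroup \<Delta> t)"
  proof (rule completely_positiveI)
    have "unitize (exp_semigroup \<Delta> t (x + y)) = unitize (exp_semigroup \<Delta> t x + exp_semigroup \<Delta> t y)"
      "unitize (exp_semigroup \<Delta> t (c *\<^sub>C x)) = unitize (c *\<^sub>C exp_semigroup \<Delta> t x)" for x y c
      by (simp_all only: unitize_exp_semigroup unitize_hom cp)
    then show "complex_linear (exp_semigroup \<Delta> t)"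
      by (simp add: complex_linear_def)
  next
    fix m and a b :: "nat \<Rightarrow> 'a"
    have "positive (unitize (\<Sum>i<m. \<Sum>j<m. star (b i) * exp_semigroup \<Delta> t (star (a i) * a j) * b j))"
      by (simp only: unitize_sum unitize_hom unitize_exp_semigroup cp)
    then show "positive (\<Sum>i<m. \<Sum>j<m. star (b i) * exp_semigroup \<Delta> t (star (a i) * a j) * b j)"
      by (simp only: positive_unitize_iff)
  qed
next
  fix t :: real and x assume "0 \<le> t"
  from U.norm_exp_semigroup_le[OF this, of "unitize x"]
  show "norm (exp_semigroup \<Delta> t x) \<le> norm x"
    by (simp only: norm_unitize flip: unitize_exp_semigroup)
next
  \<comment> \<open>The map \<open>unitize\<close> does not send a unit \<open>e\<close> of the
    algebra to 1, so unitality is argued directly from the vanishing of commutators with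
    \<open>e\<close>.\<close>
  fix e :: 'a and t :: real assume "\<forall>x. e * x = x \<and> x * e = x"
  then show "exp_semigroup \<Delta> t e = e"
    by (intro exp_semigroup_fixed) (simp_all add: \<Delta> commutator_def)
qed

lemma is_generator_exp: "is_generator (exp_semigroup \<Delta>) \<Delta>"
  unfolding is_generator_def
proof
  fix x
  have "((\<lambda>t. (1 / t) *\<^sub>R (unitize x - exp_semigroup U.gen t (unitize x))) \<longlongrightarrow> U.gen (unitize x)) (at_right 0)"
    using U.is_generator_exp_semigroup unfolding is_generator_def by blast
  then show "((\<lambda>t. (1 / t) *\<^sub>R (x - exp_semigroup \<Delta> t x)) \<longlongrightarrow> \<Delta> x) (at_right 0)"
    by (simp only: tendsto_unitize_iff flip: unitize_exp_semigroup unitize_generator unitize_hom(3,5))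
qed

end

section \<open>Coordinates for tensor modules\<close>

lemma scaleC_sum_left: "(\<Sum>i\<in>I. f i) *\<^sub>C (x :: 'a::cstar_algebra) = (\<Sum>i\<in>I. f i *\<^sub>C x)"
  by (induction I rule: infinite_finite_induct) (auto simp: scaleC_add_left)

definition lincomb :: "('p \<Rightarrow> 'a::cstar_algebra) \<Rightarrow> ('p \<Rightarrow>\<^sub>0 complex) \<Rightarrow> 'a"
  where "lincomb h f = (\<Sum>p\<in>Poly_Mapping.keys f. Poly_Mapping.lookup f p *\<^sub>C h p)"

lemma lincomb_add: "lincomb h (f + g) = lincomb h f + lincomb h g"
  unfolding lincomb_def
  by (rule setsum_keys_plus_distrib[of "\<lambda>p c. c *\<^sub>C h p"]) (auto simp: scaleC_add_left)

lemma lincomb_zero [simp]: "lincomb h 0 = 0"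
  by (simp add: lincomb_def)

lemma lincomb_sum: "lincomb h (\<Sum>x\<in>X. F x) = (\<Sum>x\<in>X. lincomb h (F x))"
  by (induction X rule: infinite_finite_induct) (auto simp: lincomb_add)

lemma lincomb_single [simp]: "lincomb h (Poly_Mapping.single p c) = c *\<^sub>C h p"
  by (simp add: lincomb_def)

lemma lincomb_map: "lincomb h (Poly_Mapping.map (\<lambda>z. c * z) f) = c *\<^sub>C lincomb h f"
proof -
  \<comment> \<open>For \<open>c = 0\<close> the support shrinks, so the sum is first extended by
    zero terms to the support of \<open>f\<close>.\<close>
  have "lincomb h (Poly_Mapping.map (\<lambda>z. c * z) f) =
      (\<Sum>p\<in>Poly_Mapping.keys f. Poly_Mapping.lookup (Poly_Mapping.map (\<lambda>z. c * z) f) p *\<^sub>C h p)"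
    unfolding lincomb_def
    by (rule sum.mono_neutral_left) (auto simp: in_keys_iff Poly_Mapping.map.rep_eq when_def)
  also have "\<dots> = c *\<^sub>C lincomb h f"
    by (auto simp: lincomb_def scaleC_sum_right scaleC_scaleC Poly_Mapping.map.rep_eq when_def in_keys_iff
      intro!: sum.cong)
  finally show ?thesis .
qed

text \<open>Only an inclusion: values of \<open>g\<close> may coincide and coefficients may cancel
  or vanish.\<close>

lemma keys_sum_single_subset:
  "Poly_Mapping.keys (\<Sum>x\<in>X. Poly_Mapping.single (g x) (c x)) \<subseteq> g ` X"
proof (induction X rule: infinite_finite_induct)
  case (insert x X)
  then show ?case
    using keys_add[of "Poly_Mapping.single (g x) (c x)" "\<Sum>x\<in>X. Poly_Mapping.single (g x) (c x)"]
    by (auto split: if_splits)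
qed auto

text \<open>A semi-inner-product module with finitely many coordinates in the algebra. By monotonicity of the
  norm on the positive cone its seminorm is equivalent to the maximum norm of the coordinates, so
  its completion can be computed coordinatewise.\<close>

locale coordinates =
  fixes M :: "('a::cstar_algebra, 'e) ip_module" and S :: "'s set" and \<theta> :: "'s \<Rightarrow> 'e \<Rightarrow> 'a"
  assumes finite_S: "finite S"
    and add_closed: "x \<in> carrier M \<Longrightarrow> y \<in> carrier M \<Longrightarrow> add M x y \<in> carrier M"
    and smul_closed: "x \<in> carrier M \<Longrightarrow> smul M c x \<in> carrier M"
    and act_closed: "x \<in> carrier M \<Longrightarrow> act M x a \<in> carrier M"
    and coord_add: "x \<in> carrier M \<Longrightarrow> y \<in> carrier M \<Longrightarrow> s \<in> S \<Longrightarrow> \<theta> s (add M x y) = \<theta> s x + \<theta> s y"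
    and coord_smul: "x \<in> carrier M \<Longrightarrow> s \<in> S \<Longrightarrow> \<theta> s (smul M c x) = c *\<^sub>C \<theta> s x"
    and coord_act: "x \<in> carrier M \<Longrightarrow> s \<in> S \<Longrightarrow> \<theta> s (act M x a) = \<theta> s x * a"
    and ip_coord: "x \<in> carrier M \<Longrightarrow> y \<in> carrier M \<Longrightarrow> ip M x y = (\<Sum>s\<in>S. star (\<theta> s x) * \<theta> s y)"
begin

lemma sub_closed: "x \<in> carrier M \<Longrightarrow> y \<in> carrier M \<Longrightarrow> sub M x y \<in> carrier M"
  by (simp add: sub_def add_closed smul_closed)

lemma coord_sub: "x \<in> carrier M \<Longrightarrow> y \<in> carrier M \<Longrightarrow> s \<in> S \<Longrightarrow> \<theta> s (sub M x y) = \<theta> s x - \<theta> s y"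
  by (simp add: sub_def smul_closed coord_add coord_smul scaleC_minus_one)

lemma norm_coord_le:
  assumes "x \<in> carrier M" "s \<in> S"
  shows "norm (\<theta> s x) \<le> seminorm M x"
proof -
  have "ip M x x = star (\<theta> s x) * \<theta> s x + (\<Sum>r\<in>S - {s}. star (\<theta> r x) * \<theta> r x)"
    by (simp add: ip_coord assms(1) sum.remove[OF finite_S assms(2)])
  moreover have "positive (\<Sum>r\<in>S - {s}. star (\<theta> r x) * \<theta> r x)" by (intro positive_sum) simp
  ultimately have "norm (star (\<theta> s x) * \<theta> s x) \<le> norm (ip M x x)"
    by (simp add: norm_le_norm_add_positive)
  then show ?thesis by (simp add: seminorm_def cstar_identity real_le_rsqrt)
qed

lemma seminorm_le:
  assumes "x \<in> carrier M"
  shows "seminorm M x \<le> (\<Sum>s\<in>S. norm (\<theta> s x))"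
proof -
  have "norm (ip M x x) \<le> (\<Sum>s\<in>S. (norm (\<theta> s x))\<^sup>2)"
    unfolding ip_coord[OF assms assms] by (rule sum_norm_le) (simp add: cstar_identity)
  then have "seminorm M x \<le> L2_set (\<lambda>s. norm (\<theta> s x)) S"
    by (simp add: seminorm_def L2_set_def)
  also have "\<dots> \<le> (\<Sum>s\<in>S. norm (\<theta> s x))" by (rule L2_set_le_sum) simp
  finally show ?thesis .
qed

lemma seminorm_tendsto_0_iff:
  assumes "\<And>n. X n \<in> carrier M"
  shows "(\<lambda>n. seminorm M (X n)) \<longlonglongrightarrow> 0 \<longleftrightarrow> (\<forall>s\<in>S. (\<lambda>n. \<theta> s (X n)) \<longlonglongrightarrow> 0)"
proof
  assume *: "(\<lambda>n. seminorm M (X n)) \<longlonglongrightarrow> 0"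
  show "\<forall>s\<in>S. (\<lambda>n. \<theta> s (X n)) \<longlonglongrightarrow> 0"
    by (intro ballI Lim_null_comparison[OF _ *] always_eventually allI norm_coord_le assms)
next
  assume "\<forall>s\<in>S. (\<lambda>n. \<theta> s (X n)) \<longlonglongrightarrow> 0"
  then have *: "(\<lambda>n. \<Sum>s\<in>S. norm (\<theta> s (X n))) \<longlonglongrightarrow> 0"
    by (intro tendsto_null_sum) (auto intro: tendsto_norm_zero)
  have "0 \<le> seminorm M x" for x by (simp add: seminorm_def)
  then show "(\<lambda>n. seminorm M (X n)) \<longlonglongrightarrow> 0"
    by (intro Lim_null_comparison[OF _ *] always_eventually allI) (simp add: seminorm_le assms)
qed

lemma cauchy_in_carrier: "cauchy_in M X \<Longrightarrow> X n \<in> carrier M"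
  by (auto simp: cauchy_in_def)

lemma cauchy_in_coord:
  assumes X: "cauchy_in M X" and s: "s \<in> S"
  shows "Cauchy (\<lambda>n. \<theta> s (X n))"
proof (rule metric_CauchyI)
  fix e :: real assume "e > 0"
  with X have "\<exists>N. \<forall>m\<ge>N. \<forall>n\<ge>N. seminorm M (sub M (X m) (X n)) < e"
    by (simp only: cauchy_in_def)
  then obtain N where N: "\<forall>m\<ge>N. \<forall>n\<ge>N. seminorm M (sub M (X m) (X n)) < e" ..
  note car = cauchy_in_carrier[OF X]
  have "dist (\<theta> s (X m)) (\<theta> s (X n)) < e" if "m \<ge> N" "n \<ge> N" for m n
  proof -
    have "norm (\<theta> s (X m) - \<theta> s (X n)) \<le> seminorm M (sub M (X m) (X n))"
      using norm_coord_le[OF sub_closed[OF car car] s, of m n] unfolding coord_sub[OF car car s] .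
    also have "\<dots> < e" using N that by (simp only:)
    finally show ?thesis by (simp only: dist_norm)
  qed
  then show "\<exists>N. \<forall>m\<ge>N. \<forall>n\<ge>N. dist (\<theta> s (X m)) (\<theta> s (X n)) < e" by blast
qed

lemma cauchy_inI:
  assumes car: "\<And>n. X n \<in> carrier M" and C: "\<And>s. s \<in> S \<Longrightarrow> Cauchy (\<lambda>n. \<theta> s (X n))"
  shows "cauchy_in M X"
  unfolding cauchy_in_def
proof (intro conjI allI impI)
  show "range X \<subseteq> carrier M" using car by auto
  fix e :: real assume "e > 0"
  \<comment> \<open>The added 1 keeps the denominator positive for empty \<open>S\<close> and makes
    the final estimate strict. Below, \<open>sum N S\<close> serves as a common index bound that
    also makes sense for empty \<open>S\<close>.\<close>
  define d where "d = e / (real (card S) + 1)"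
  have "d > 0" using \<open>e > 0\<close> by (simp add: d_def)
  have "\<forall>s\<in>S. \<exists>N. \<forall>m\<ge>N. \<forall>n\<ge>N. dist (\<theta> s (X m)) (\<theta> s (X n)) < d"
    using metric_CauchyD[OF C \<open>d > 0\<close>] by blast
  from bchoice[OF this] obtain N
    where N: "\<forall>s\<in>S. \<forall>m\<ge>N s. \<forall>n\<ge>N s. dist (\<theta> s (X m)) (\<theta> s (X n)) < d" ..
  have N_le: "s \<in> S \<Longrightarrow> N s \<le> sum N S" for s by (rule member_le_sum) (auto simp: finite_S)
  have "seminorm M (sub M (X m) (X n)) < e" if mn: "m \<ge> sum N S" "n \<ge> sum N S" for m n
  proof -
    have "seminorm M (sub M (X m) (X n)) \<le> (\<Sum>s\<in>S. norm (\<theta> s (sub M (X m) (X n))))"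
      by (intro seminorm_le sub_closed car)
    also have "\<dots> \<le> (\<Sum>s\<in>S. d)"
    proof (rule sum_mono)
      fix s assume s: "s \<in> S"
      then have "N s \<le> m" "N s \<le> n" using N_le[OF s] mn by linarith+
      then have "dist (\<theta> s (X m)) (\<theta> s (X n)) < d" using N s by blast
      then show "norm (\<theta> s (sub M (X m) (X n))) \<le> d" by (simp add: coord_sub car s dist_norm)
    qed
    also have "\<dots> < e"
    proof -
      have "real (card S) * e < e * (real (card S) + 1)" using \<open>e > 0\<close> by (simp add: algebra_simps)
      then show ?thesis by (simp add: d_def pos_divide_less_eq)
    qed
    finally show ?thesis .
  qed
  then show "\<exists>N. \<forall>m\<ge>N. \<forall>n\<ge>N. seminorm M (sub M (X m) (X n)) < e" by blast
qed

lemma cauchy_in_iff: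
  "cauchy_in M X \<longleftrightarrow> (\<forall>n. X n \<in> carrier M) \<and> (\<forall>s\<in>S. Cauchy (\<lambda>n. \<theta> s (X n)))"
  by (blast intro: cauchy_in_coord cauchy_inI dest: cauchy_in_carrier)

definition lim_coord :: "(nat \<Rightarrow> 'e) \<Rightarrow> 's \<Rightarrow> 'a"
  where "lim_coord X s = lim (\<lambda>n. \<theta> s (X n))"

lemma tendsto_lim_coord: "cauchy_in M X \<Longrightarrow> s \<in> S \<Longrightarrow> (\<lambda>n. \<theta> s (X n)) \<longlonglongrightarrow> lim_coord X s"
  by (simp add: cauchy_in_coord lim_coord_def Cauchy_convergent flip: convergent_LIMSEQ_iff)

text \<open>Convergence to zero can be tested on coordinates, whose limits exist because the algebra
  is complete. A point of the completion is therefore determined by its tuple of coordinate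
  limits.\<close>

lemma cauchy_rel_iff:
  "(X, Y) \<in> cauchy_rel M \<longleftrightarrow>
    cauchy_in M X \<and> cauchy_in M Y \<and> (\<forall>s\<in>S. lim_coord X s = lim_coord Y s)"
proof -
  have "(\<lambda>n. seminorm M (sub M (X n) (Y n))) \<longlonglongrightarrow> 0 \<longleftrightarrow> (\<forall>s\<in>S. lim_coord X s = lim_coord Y s)"
    if X: "cauchy_in M X" and Y: "cauchy_in M Y"
  proof -
    have car: "X n \<in> carrier M" "Y n \<in> carrier M" for n using X Y by (auto simp: cauchy_in_iff)
    have "(\<lambda>n. seminorm M (sub M (X n) (Y n))) \<longlonglongrightarrow> 0 \<longleftrightarrow> (\<forall>s\<in>S. (\<lambda>n. \<theta> s (X n) - \<theta> s (Y n)) \<longlonglongrightarrow> 0)"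
      by (subst seminorm_tendsto_0_iff) (auto simp: car sub_closed coord_sub)
    also have "\<dots> \<longleftrightarrow> (\<forall>s\<in>S. lim_coord X s - lim_coord Y s = 0)"
    proof (intro ball_cong refl)
      fix s assume s: "s \<in> S"
      have "(\<lambda>n. \<theta> s (X n) - \<theta> s (Y n)) \<longlonglongrightarrow> lim_coord X s - lim_coord Y s"
        by (intro tendsto_diff tendsto_lim_coord X Y s)
      then show "(\<lambda>n. \<theta> s (X n) - \<theta> s (Y n)) \<longlonglongrightarrow> 0 \<longleftrightarrow> lim_coord X s - lim_coord Y s = 0"
        using LIMSEQ_unique[of _ "lim_coord X s - lim_coord Y s" 0] by auto
    qed
    finally show ?thesis by simp
  qed
  then show ?thesis by (auto simp: cauchy_rel_def)
qed

lemma cauchy_class_eq: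
  "cauchy_in M X \<Longrightarrow> cauchy_class M X = {Y. cauchy_in M Y \<and> (\<forall>s\<in>S. lim_coord X s = lim_coord Y s)}"
  by (auto simp: cauchy_class_def cauchy_rel_iff)

lemma carrier_completion: "carrier (completion M) = {cauchy_class M X |X. cauchy_in M X}"
  by (auto simp: completion_def quotient_def cauchy_class_def)

section \<open>Operations of the completion in coordinates\<close>

definition coord :: "'s \<Rightarrow> (nat \<Rightarrow> 'e) set \<Rightarrow> 'a"
  where "coord s P = lim_coord (representative P) s"

text \<open>The representative is an arbitrary choice; later computations go through coordinate
  limits because all members of a class share them.\<close>

lemma representative:
  assumes "cauchy_in M X"
  shows "cauchy_in M (representative (cauchy_class M X))"
    and "s \<in> S \<Longrightarrow> coord s (cauchy_class M X) = lim_coord X s"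
proof -
  have "X \<in> cauchy_class M X" using assms by (simp add: cauchy_class_eq)
  then have "representative (cauchy_class M X) \<in> cauchy_class M X"
    unfolding representative_def by (rule someI[where P="\<lambda>Y. Y \<in> cauchy_class M X"])
  then show "cauchy_in M (representative (cauchy_class M X))"
    and "s \<in> S \<Longrightarrow> coord s (cauchy_class M X) = lim_coord X s"
    using assms by (auto simp: cauchy_class_eq coord_def)
qed

lemma cauchy_representative: "P \<in> carrier (completion M) \<Longrightarrow> cauchy_in M (representative P)"
  by (auto simp: carrier_completion representative)

lemma representative_in: "P \<in> carrier (completion M) \<Longrightarrow> representative P n \<in> carrier M"
  using cauchy_representative[of P] by (simp add: cauchy_in_iff)

lemma tendsto_coord:
  "P \<in> carrier (completion M) \<Longrightarrow> s \<in> S \<Longrightarrow> (\<lambda>n. \<theta> s (representative P n)) \<longlonglongrightarrow> coord s P"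
  unfolding coord_def by (intro tendsto_lim_coord cauchy_representative)

lemma completion_eqI:
  assumes "P \<in> carrier (completion M)" "Q \<in> carrier (completion M)"
    and "\<And>s. s \<in> S \<Longrightarrow> coord s P = coord s Q"
  shows "P = Q"
proof -
  obtain X Y where X: "cauchy_in M X" "P = cauchy_class M X" and Y: "cauchy_in M Y" "Q = cauchy_class M Y"
    using assms(1,2) by (auto simp: carrier_completion)
  have "lim_coord X s = lim_coord Y s" if "s \<in> S" for s
    using assms(3)[OF that] representative(2)[OF X(1) that] representative(2)[OF Y(1) that]
    by (simp only: X(2) Y(2))
  then show ?thesis unfolding X(2) Y(2) cauchy_class_eq[OF X(1)] cauchy_class_eq[OF Y(1)] by auto
qed

text \<open>Each operation of the completion returns the class of a termwise sequence; knowing the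
  coordinate limits of that sequence gives both membership and the coordinates of the
  result.\<close>

lemma cauchy_classI:
  assumes "\<And>n. X n \<in> carrier M" "\<And>s. s \<in> S \<Longrightarrow> (\<lambda>n. \<theta> s (X n)) \<longlonglongrightarrow> L s"
  shows "cauchy_class M X \<in> carrier (completion M)"
    and "s \<in> S \<Longrightarrow> coord s (cauchy_class M X) = L s"
proof -
  have "cauchy_in M X" unfolding cauchy_in_iff using assms by (auto intro: LIMSEQ_imp_Cauchy)
  then show "cauchy_class M X \<in> carrier (completion M)"
    and "s \<in> S \<Longrightarrow> coord s (cauchy_class M X) = L s"
    using assms(2) by (auto simp: carrier_completion representative lim_coord_def limI)
qed

lemma completion_add:
  assumes "P \<in> carrier (completion M)" "Q \<in> carrier (completion M)"
  shows "add (completion M) P Q \<in> carrier (completion M)"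
    and "s \<in> S \<Longrightarrow> coord s (add (completion M) P Q) = coord s P + coord s Q"
proof -
  let ?X = "\<lambda>n. add M (representative P n) (representative Q n)"
  have eq: "add (completion M) P Q = cauchy_class M ?X" by (simp add: completion_def)
  have "(\<lambda>n. \<theta> s (?X n)) \<longlonglongrightarrow> coord s P + coord s Q" if "s \<in> S" for s
    using tendsto_add[OF tendsto_coord[OF assms(1) that] tendsto_coord[OF assms(2) that]] that
    by (simp add: coord_add representative_in assms)
  note limit = cauchy_classI[of ?X, OF add_closed[OF representative_in[OF assms(1)] representative_in[OF assms(2)]] this]
  show "add (completion M) P Q \<in> carrier (completion M)" unfolding eq by (rule limit(1))
  show "coord s (add (completion M) P Q) = coord s P + coord s Q" if "s \<in> S" unfolding eq
    by (rule limit(2)) (use that in auto)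
qed

lemma completion_smul:
  assumes "P \<in> carrier (completion M)"
  shows "smul (completion M) c P \<in> carrier (completion M)"
    and "s \<in> S \<Longrightarrow> coord s (smul (completion M) c P) = c *\<^sub>C coord s P"
proof -
  let ?X = "\<lambda>n. smul M c (representative P n)"
  have eq: "smul (completion M) c P = cauchy_class M ?X" by (simp add: completion_def)
  have "(\<lambda>n. \<theta> s (?X n)) \<longlonglongrightarrow> c *\<^sub>C coord s P" if "s \<in> S" for s
    using bounded_linear.tendsto[OF bounded_linear_scaleC tendsto_coord[OF assms(1) that], of c] that
    by (simp add: coord_smul representative_in assms)
  note limit = cauchy_classI[of ?X, OF smul_closed[OF representative_in[OF assms]] this]
  show "smul (completion M) c P \<in> carrier (completion M)" unfolding eq by (rule limit(1))
  show "coord s (smul (completion M) c P) = c *\<^sub>C coord s P" if "s \<in> S" unfolding eq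
    by (rule limit(2)) (use that in auto)
qed

lemma completion_act:
  assumes "P \<in> carrier (completion M)"
  shows "act (completion M) P a \<in> carrier (completion M)"
    and "s \<in> S \<Longrightarrow> coord s (act (completion M) P a) = coord s P * a"
proof -
  let ?X = "\<lambda>n. act M (representative P n) a"
  have eq: "act (completion M) P a = cauchy_class M ?X" by (simp add: completion_def)
  have "(\<lambda>n. \<theta> s (?X n)) \<longlonglongrightarrow> coord s P * a" if "s \<in> S" for s
    using tendsto_mult[OF tendsto_coord[OF assms(1) that] tendsto_const, of a] that
    by (simp add: coord_act representative_in assms)
  note limit = cauchy_classI[of ?X, OF act_closed[OF representative_in[OF assms]] this]
  show "act (completion M) P a \<in> carrier (completion M)" unfolding eq by (rule limit(1))
  show "coord s (act (completion M) P a) = coord s P * a" if "s \<in> S" unfolding eq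
    by (rule limit(2)) (use that in auto)
qed

lemma completion_ip:
  assumes "P \<in> carrier (completion M)" "Q \<in> carrier (completion M)"
  shows "ip (completion M) P Q = (\<Sum>s\<in>S. star (coord s P) * coord s Q)"
proof -
  have "(\<lambda>n. \<Sum>s\<in>S. star (\<theta> s (representative P n)) * \<theta> s (representative Q n))
      \<longlonglongrightarrow> (\<Sum>s\<in>S. star (coord s P) * coord s Q)"
    by (intro tendsto_sum tendsto_mult bounded_linear.tendsto[OF bounded_linear_star] tendsto_coord assms)
  from limI[OF this] show ?thesis
    by (simp add: completion_def ip_coord[OF representative_in[OF assms(1)] representative_in[OF assms(2)]])
qed

end

text \<open>The map \<open>w\<close> need only match coordinates: elements of the target completion
  with equal coordinates are equal, which yields additivity and linearity of the induced map, and
  inner products are computed from coordinates on both sides.\<close>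

lemma module_isometry_completionI:
  assumes "coordinates E S \<theta>" and "coordinates F S \<phi>"
    and w: "\<And>x. x \<in> carrier E \<Longrightarrow> w x \<in> carrier F"
      "\<And>x s. x \<in> carrier E \<Longrightarrow> s \<in> S \<Longrightarrow> \<phi> s (w x) = \<theta> s x"
  shows "module_isometry (completion E) (completion F)
    (\<lambda>P. cauchy_class F (\<lambda>n. w (representative P n)))"
proof -
  interpret E: coordinates E S \<theta> by fact
  interpret F: coordinates F S \<phi> by fact
  define W where "W = (\<lambda>P. cauchy_class F (\<lambda>n. w (representative P n)))"
  have "(\<lambda>n. \<phi> s (w (representative P n))) \<longlonglongrightarrow> E.coord s P"
    if "P \<in> carrier (completion E)" "s \<in> S" for P s
    using E.tendsto_coord[OF that] that by (simp add: w E.representative_in)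
  note limit = F.cauchy_classI[of "\<lambda>n. w (representative P n)" "\<lambda>s. E.coord s P" for P,
    OF w(1)[OF E.representative_in] this]
  have W: "W P \<in> carrier (completion F)" if "P \<in> carrier (completion E)" for P
    unfolding W_def by (rule limit(1)) (use that in auto)
  have coord_W: "F.coord s (W P) = E.coord s P" if "P \<in> carrier (completion E)" "s \<in> S" for P s
    unfolding W_def by (rule limit(2)) (use that in auto)
  have "module_isometry (completion E) (completion F) W"
    unfolding module_isometry_def
    by (intro conjI ballI allI F.completion_eqI)
      (simp_all add: W coord_W F.completion_add F.completion_smul F.completion_act F.completion_ip
        E.completion_add E.completion_smul E.completion_act E.completion_ip)
  then show ?thesis by (simp only: W_def)
qed

text \<open>A kernel of Gram type: its sesquilinear extension factors through the linear extensions
  of the \<open>h s\<close>, and compatibility of \<open>h s\<close> with right multiplication makes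
  these extensions module maps.\<close>

lemma coordinates_formal_tensors:
  fixes k :: "'v \<times> 'a \<Rightarrow> 'v \<times> 'a \<Rightarrow> 'a::cstar_algebra" and h :: "'s \<Rightarrow> 'v \<times> 'a \<Rightarrow> 'a"
  assumes "finite S"
    and k: "\<And>p q. k p q = (\<Sum>s\<in>S. star (h s p) * h s q)"
    and h: "\<And>s v b a. s \<in> S \<Longrightarrow> h s (v, b * a) = h s (v, b) * a"
  shows "coordinates (formal_tensors A k) S (\<lambda>s. lincomb (h s))"
proof
  fix x y :: "('v \<times> 'a) \<Rightarrow>\<^sub>0 complex" and c :: complex and a :: 'a and s :: 's
  assume x: "x \<in> carrier (formal_tensors A k)"
  then have kx: "Poly_Mapping.keys x \<subseteq> A \<times> UNIV" by (simp add: formal_tensors_def)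
  show "smul (formal_tensors A k) c x \<in> carrier (formal_tensors A k)"
    using kx by (auto simp: formal_tensors_def in_keys_iff Poly_Mapping.map.rep_eq when_def split: if_splits)
  show "act (formal_tensors A k) x a \<in> carrier (formal_tensors A k)"
  proof -
    have "(\<lambda>p. (fst p, snd p * a)) ` Poly_Mapping.keys x \<subseteq> A \<times> UNIV" using kx by force
    from order_trans[OF keys_sum_single_subset this] show ?thesis
      by (simp add: formal_tensors_def)
  qed
  show "lincomb (h s) (smul (formal_tensors A k) c x) = c *\<^sub>C lincomb (h s) x"
    by (simp add: formal_tensors_def lincomb_map)
  show "lincomb (h s) (act (formal_tensors A k) x a) = lincomb (h s) x * a" if "s \<in> S"
    using h[OF that]
    by (simp add: formal_tensors_def lincomb_sum lincomb_def[of "h s" x] sum_distrib_right mult_scaleC_left)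
  show "lincomb (h s) (add (formal_tensors A k) x y) = lincomb (h s) x + lincomb (h s) y"
    by (simp add: formal_tensors_def lincomb_add)
  assume y: "y \<in> carrier (formal_tensors A k)"
  then show "add (formal_tensors A k) x y \<in> carrier (formal_tensors A k)"
    using kx keys_add[of x y] by (auto simp: formal_tensors_def)
  have "ip (formal_tensors A k) x y = (\<Sum>p\<in>Poly_Mapping.keys x. \<Sum>q\<in>Poly_Mapping.keys y. \<Sum>s\<in>S.
      star (Poly_Mapping.lookup x p *\<^sub>C h s p) * (Poly_Mapping.lookup y q *\<^sub>C h s q))"
    by (simp add: formal_tensors_def k scaleC_sum_right cstar_simps mult.commute)
  also have "\<dots> = (\<Sum>p\<in>Poly_Mapping.keys x. \<Sum>s\<in>S. \<Sum>q\<in>Poly_Mapping.keys y.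
      star (Poly_Mapping.lookup x p *\<^sub>C h s p) * (Poly_Mapping.lookup y q *\<^sub>C h s q))"
    by (intro sum.cong refl sum.swap)
  also have "\<dots> = (\<Sum>s\<in>S. \<Sum>p\<in>Poly_Mapping.keys x. \<Sum>q\<in>Poly_Mapping.keys y.
      star (Poly_Mapping.lookup x p *\<^sub>C h s p) * (Poly_Mapping.lookup y q *\<^sub>C h s q))"
    by (rule sum.swap)
  also have "\<dots> = (\<Sum>s\<in>S. star (lincomb (h s) x) * lincomb (h s) y)"
    by (simp add: lincomb_def star_sum sum_product)
  finally show "ip (formal_tensors A k) x y = (\<Sum>s\<in>S. star (lincomb (h s) x) * lincomb (h s) y)" .
qed fact

text \<open>The space of square-summable families over \<open>S\<close>, realised by functions on
  the whole type that vanish off \<open>S\<close>, so that a finite subset of any type can index an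
  orthonormal basis.\<close>

definition finite_l2 :: "'s set \<Rightarrow> (complex, 's \<Rightarrow> complex) ip_module"
  where "finite_l2 S =
    \<lparr> carrier = {f. \<forall>x. x \<notin> S \<longrightarrow> f x = 0}, zero = (\<lambda>x. 0), add = (\<lambda>f g x. f x + g x),
      smul = (\<lambda>c f x. c * f x), act = (\<lambda>f c x. f x * c), ip = (\<lambda>f g. \<Sum>s\<in>S. cnj (f s) * g s) \<rparr>"

lemma hilbert_space_finite_l2:
  assumes "finite S"
  shows "hilbert_space (finite_l2 S)"
proof -
  interpret coordinates "finite_l2 S" S "\<lambda>s f. f s"
    by unfold_locales (auto simp: finite_l2_def assms scaleC_complex_def star_complex_def)
  have complete: "\<exists>x\<in>carrier (finite_l2 S). (\<lambda>n. seminorm (finite_l2 S) (sub (finite_l2 S) (X n) x)) \<longlonglongrightarrow> 0"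
    if X: "cauchy_in (finite_l2 S) X" for X
  proof
    \<comment> \<open>Extension by 0 off \<open>S\<close> keeps the limit in the carrier.\<close>
    let ?x = "\<lambda>s. if s \<in> S then lim_coord X s else 0"
    show x: "?x \<in> carrier (finite_l2 S)" by (simp add: finite_l2_def)
    have car: "X n \<in> carrier (finite_l2 S)" for n using X by (simp add: cauchy_in_iff)
    show "(\<lambda>n. seminorm (finite_l2 S) (sub (finite_l2 S) (X n) ?x)) \<longlonglongrightarrow> 0"
      using tendsto_lim_coord[OF X]
      by (subst seminorm_tendsto_0_iff) (auto simp: sub_closed car x coord_sub LIM_zero_iff)
  qed
  have pos: "positive (ip (finite_l2 S) x x)" for x
    using positive_sum[of S "\<lambda>s. cnj (x s) * x s"] positive_star_mult[of "x s" for s]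
    by (simp add: finite_l2_def star_complex_def)
  have nondegenerate: "x = zero (finite_l2 S)" if "x \<in> carrier (finite_l2 S)" "ip (finite_l2 S) x x = 0" for x
  proof -
    have "x s = 0" if "s \<in> S" for s
      using norm_coord_le[OF \<open>x \<in> carrier _\<close> that] \<open>ip _ x x = 0\<close> by (simp add: seminorm_def)
    then show ?thesis using that(1) by (auto simp: finite_l2_def)
  qed
  show ?thesis
    unfolding hilbert_module_def
    by (intro conjI)
      (use complete pos nondegenerate in \<open>auto simp: finite_l2_def sub_def algebra_simps sum.distrib
        sum_distrib_left sum_distrib_right scaleC_complex_def star_complex_def\<close>)
qed

lemma coordinates_standard_form:
  assumes "finite S"
  shows "coordinates (formal_tensors A (standard_form (finite_l2 S))) S (\<lambda>s. lincomb (\<lambda>(\<xi>, b). \<xi> s *\<^sub>C b))"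
  by (rule coordinates_formal_tensors[OF assms])
    (auto simp: standard_form_def finite_l2_def cstar_simps scaleC_sum_left mult.commute split: prod.splits)

section \<open>The isometry into the standard module\<close>

lemma carre_du_champ_normal:
  fixes u :: "'a::cstar_algebra"
  assumes normal: "u * star u = star u * u"
  defines "D \<equiv> \<lambda>x. commutator (star u) (commutator u x)"
  shows "star a * D c + D (star a) * c - D (star a * c) =
    star (commutator u a) * commutator u c + star (commutator (star u) a) * commutator (star u) c"
proof -
  have "u * (star u * y) = star u * (u * y)" for y
    by (simp only: normal flip: mult.assoc)
  then show ?thesis
    by (simp add: D_def commutator_def star_diff star_mult star_star right_diff_distrib left_diff_distrib
        mult.assoc normal)
qed

lemma generator_form_eq:
  fixes V :: "'i \<Rightarrow> 'a::cstar_algebra"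
  assumes normal: "\<And>i. i \<in> I \<Longrightarrow> V i * star (V i) = star (V i) * V i"
    and \<Delta>: "\<Delta> = (\<lambda>x. \<Sum>i\<in>I. commutator (star (V i)) (commutator (V i) x))"
  shows "generator_form \<Delta> (a, b) (c, d) = (\<Sum>i\<in>I.
    star (commutator (V i) a * b) * (commutator (V i) c * d) +
    star (commutator (star (V i)) a * b) * (commutator (star (V i)) c * d))"
proof -
  have "star a * \<Delta> c + \<Delta> (star a) * c - \<Delta> (star a * c) = (\<Sum>i\<in>I.
      star (commutator (V i) a) * commutator (V i) c +
      star (commutator (star (V i)) a) * commutator (star (V i)) c)"
    by (simp add: \<Delta> sum_distrib_left sum_distrib_right carre_du_champ_normal normal
      flip: sum.distrib sum_subtractf)
  then show ?thesis
    by (simp add: generator_form_def sum_distrib_left sum_distrib_right distrib_left distrib_right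
      star_mult mult.assoc)
qed

text \<open>The index type is free here; taking it to be the algebra itself gives
  \<open>finite_l2 S\<close> the carrier type that \<open>strongly_local\<close> demands.\<close>

lemma module_isometry_commutators:
  fixes S :: "'s set" and V :: "'s \<Rightarrow> 'a::cstar_algebra"
  assumes S: "finite S"
    and form: "\<And>a b c d. generator_form \<Delta> (a, b) (c, d) =
      (\<Sum>s\<in>S. star (commutator (V s) a * b) * (commutator (V s) c * d))"
  shows "\<exists>W. module_isometry (tensor_module UNIV (generator_form \<Delta>))
    (tensor_module (carrier (finite_l2 S)) (standard_form (finite_l2 S))) W"
proof -
  define e :: "'s \<Rightarrow> 's \<Rightarrow> complex" where "e = (\<lambda>s x. if x = s then 1 else 0)"
  define w :: "('a \<times> 'a \<Rightarrow>\<^sub>0 complex) \<Rightarrow> (('s \<Rightarrow> complex) \<times> 'a \<Rightarrow>\<^sub>0 complex)" where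
    "w x = (\<Sum>p\<in>Poly_Mapping.keys x. \<Sum>s\<in>S.
      Poly_Mapping.single (e s, commutator (V s) (fst p) * snd p) (Poly_Mapping.lookup x p))" for x
  have "module_isometry (completion (formal_tensors UNIV (generator_form \<Delta>)))
    (completion (formal_tensors (carrier (finite_l2 S)) (standard_form (finite_l2 S))))
    (\<lambda>P. cauchy_class (formal_tensors (carrier (finite_l2 S)) (standard_form (finite_l2 S)))
      (\<lambda>n. w (representative P n)))"
  proof (rule module_isometry_completionI)
    show "coordinates (formal_tensors UNIV (generator_form \<Delta>)) S
        (\<lambda>s. lincomb (\<lambda>(a, b). commutator (V s) a * b))"
      by (rule coordinates_formal_tensors[OF S]) (auto simp: form mult.assoc)
    show "coordinates (formal_tensors (carrier (finite_l2 S)) (standard_form (finite_l2 S))) S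
        (\<lambda>s. lincomb (\<lambda>(\<xi>, b). \<xi> s *\<^sub>C b))"
      by (rule coordinates_standard_form[OF S])
    fix x :: "'a \<times> 'a \<Rightarrow>\<^sub>0 complex"
    have sub: "(\<lambda>(p, s). (e s, commutator (V s) (fst p) * snd p)) ` (Poly_Mapping.keys x \<times> S)
        \<subseteq> carrier (finite_l2 S) \<times> UNIV"
      by (auto simp: finite_l2_def e_def)
    \<comment> \<open>Written as one sum over pairs, \<open>w x\<close> falls under
      \<open>keys_sum_single_subset\<close>.\<close>
    have "w x = (\<Sum>q\<in>Poly_Mapping.keys x \<times> S.
        Poly_Mapping.single ((\<lambda>(p, s). (e s, commutator (V s) (fst p) * snd p)) q) (Poly_Mapping.lookup x (fst q)))"
      by (simp add: w_def sum.cartesian_product case_prod_unfold)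
    with order_trans[OF keys_sum_single_subset sub] have "Poly_Mapping.keys (w x) \<subseteq> carrier (finite_l2 S) \<times> UNIV"
      by (simp only:)
    then show "w x \<in> carrier (formal_tensors (carrier (finite_l2 S)) (standard_form (finite_l2 S)))"
      by (simp add: formal_tensors_def)
    fix s assume s: "s \<in> S"
    have "(\<Sum>r\<in>S. c *\<^sub>C e r s *\<^sub>C f r) = c *\<^sub>C f s" for c and f :: "'s \<Rightarrow> 'a"
    proof -
      have "(\<Sum>r\<in>S. c *\<^sub>C e r s *\<^sub>C f r) = (\<Sum>r\<in>S. if r = s then c *\<^sub>C f r else 0)"
        by (intro sum.cong) (auto simp: e_def)
      then show ?thesis using s S by simp
    qed
    then show "lincomb (\<lambda>(\<xi>, b). \<xi> s *\<^sub>C b) (w x) = lincomb (\<lambda>(a, b). commutator (V s) a * b) x"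
      by (simp add: w_def lincomb_sum lincomb_def[of _ x] case_prod_unfold)
  qed
  then show ?thesis unfolding tensor_module_def by blast
qed

text \<open>A nonzero vector spans a real line. This supplies finite subsets of the algebra of every
  size, to be used as index sets.\<close>

lemma infinite_UNIV_if_nonzero:
  assumes "(x :: 'a::real_normed_vector) \<noteq> 0"
  shows "infinite (UNIV :: 'a set)"
proof
  assume "finite (UNIV :: 'a set)"
  then have "finite (range (\<lambda>r :: real. r *\<^sub>R x))" by (rule rev_finite_subset) simp
  moreover have "inj (\<lambda>r :: real. r *\<^sub>R x)" using assms by (auto intro: injI)
  ultimately have "finite (UNIV :: real set)" by (rule finite_imageD)
  then show False by (simp add: infinite_UNIV_char_0)
qed

theorem theorem2p4:
  fixes \<tau> :: "'a::cstar_algebra \<Rightarrow> ennreal"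
    and U :: "nat \<Rightarrow> 'a"
    and n :: nat
    and \<Delta> :: "'a \<Rightarrow> 'a"
  assumes "\<exists>x y :: 'a. x * y \<noteq> y * x"
    and "is_trace \<tau>" and "lower_semicontinuous_trace \<tau>" and "faithful_trace \<tau>"
    and "differential_basis n U"
    and "\<Delta> = (\<lambda>x. \<Sum>j=1..n. commutator (star (U j)) (commutator (U j) x))"
  shows "strongly_local (exp_semigroup \<Delta>) \<Delta>"
proof -
  have comm: "U i * U j = U j * U i" "U i * star (U j) = star (U j) * U i"
    if "i \<in> {1..n}" "j \<in> {1..n}" for i j
    using assms(5) that by (auto simp: differential_basis_def commutator_def)
  \<comment> \<open>The pair \<open>(j, True)\<close> stands for \<open>U j\<close> and
    \<open>(j, False)\<close> for \<open>star (U j)\<close>, giving 2n indices even when some of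
    these elements coincide.\<close>
  let ?I = "{1..n} \<times> (UNIV :: bool set)"
  \<comment> \<open>Noncommutativity provides a nonzero element, so the algebra has a subset
    \<open>S\<close> with 2n elements, and \<open>g\<close> transports the indices to it.\<close>
  obtain x :: 'a where "x \<noteq> 0" using assms(1) by (metis mult_zero_left mult_zero_right)
  from infinite_arbitrarily_large[OF infinite_UNIV_if_nonzero[OF this]]
  obtain S :: "'a set" where S: "finite S" "card S = card ?I" by blast
  then obtain g where g: "bij_betw g S ?I"
    using finite_same_card_bij[of S ?I] by auto
  define V where "V = (\<lambda>(j, b). if b then U j else star (U j))"
  have "generator_form \<Delta> (a, b) (c, d) =
      (\<Sum>s\<in>S. star (commutator (V (g s)) a * b) * (commutator (V (g s)) c * d))" for a b c d
  proof -
    have "generator_form \<Delta> (a, b) (c, d) =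
        (\<Sum>j=1..n. \<Sum>t\<in>UNIV. star (commutator (V (j, t)) a * b) * (commutator (V (j, t)) c * d))"
      using comm by (subst generator_form_eq[OF _ assms(6)]) (auto simp: UNIV_bool V_def add.commute)
    also have "\<dots> = (\<Sum>i\<in>?I. star (commutator (V i) a * b) * (commutator (V i) c * d))"
      by (simp add: sum.cartesian_product case_prod_unfold)
    also have "\<dots> = (\<Sum>s\<in>S. star (commutator (V (g s)) a * b) * (commutator (V (g s)) c * d))"
      by (rule sum.reindex_bij_betw[OF g, symmetric])
    finally show ?thesis .
  qed
  from module_isometry_commutators[OF S(1) this] hilbert_space_finite_l2[OF S(1)]
    cp_markov_exp_semigroup[OF comm assms(6)] is_generator_exp[OF comm assms(6)]
  show ?thesis unfolding strongly_local_def by blast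
qed

end
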